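(* Let each odd vertex of $\mathbb{Z}^2$ be closed with probability $p>0$, independently for different vertices, and let all even vertices be open. There exist constants $c_1,C_1>0$ such that, for any initial vertex $v$, with high probability as $p\to0$ (i.e. with probability tending to $1$ as $p\to 0$), the time $T=T_v$ for Eve to win Trap on the open subgraph of $\mathbb{Z}^2$ satisfies $$\frac{c_1}{p\log p^{-1}}\le T\le\frac{C_1\log^2p^{-1}}{p^2}.$$
   Context: $\mathbb{Z}^2$ is the square lattice graph, with $u\sim v$ iff $\|u-v\|_1=1$. A vertex is odd or even according to the parity of the sum of its coordinates. Trap: a token starts at an initial vertex of a graph; two players alternately move it along an incident edge to a vertex never visited before (the initial vertex counts as visited). A player who has no possible move loses and the other wins. A strategy for a player assigns a legal next move (where one exists) to each position (location of token together with the set of visited vertices). Vertices that are not closed are open; Trap on the open subgraph means moves to closed vertices are forbidden. By convention the game is a first-player win if the initial vertex is closed. The configuration is known to both players. Odin is the player who moves from even vertices to odd vertices; Eve is the player who moves from odd vertices to even vertices. Thus if the initial vertex is even Odin moves first, and if it is odd Eve moves first. Time to win: for an initial vertex $v$, let $\mathbf{E}$ and $\mathbf{O}$ be the sets of all strategies for Eve and Odin starting from $v$. For $\mathbf{e}\in\mathbf{E}$, $\mathbf{o}\in\mathbf{O}$ let $T(\mathbf{e},\mathbf{o})$ be the number of turns until the game terminates when Eve plays $\mathbf{e}$ and Odin plays $\mathbf{o}$, provided Eve wins; if Eve does not win with this pair of strategies, let $T(\mathbf{e},\mathbf{o})=\infty$. Define $T_v:=\inf_{\mathbf{e}\in\mathbf{E}}\sup_{\mathbf{o}\in\mathbf{O}}T(\mathbf{e},\mathbf{o})$.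 *)

theory Defs
  imports "HOL-Probability.Probability"
begin

type_synonym vertex = "int \<times> int"

definition adjacent :: "vertex \<Rightarrow> vertex \<Rightarrow> bool" where
  "adjacent u v \<longleftrightarrow> \<bar>fst u - fst v\<bar> + \<bar>snd u - snd v\<bar> = 1"

definition odd_vertex :: "vertex \<Rightarrow> bool" where
  "odd_vertex v \<longleftrightarrow> odd (fst v + snd v)"

text \<open>A position is the location of the token together with the set of visited vertices
  (including the current location). Throughout, \<open>K\<close> is the set of closed vertices.\<close>

type_synonym position = "vertex \<times> vertex set"

datatype player = Eve | Odin

definition to_move :: "position \<Rightarrow> player" where
  "to_move q = (if odd_vertex (fst q) then Eve else Odin)"

definition legal_moves :: "vertex set \<Rightarrow> position \<Rightarrow> vertex set" where
  "legal_moves K q = {y. adjacent (fst q) y \<and> y \<notin> snd q \<and> y \<notin> K}"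

definition move_to :: "position \<Rightarrow> vertex \<Rightarrow> position" where
  "move_to q y = (y, insert y (snd q))"

inductive_set positions :: "vertex set \<Rightarrow> vertex \<Rightarrow> position set"
  for K :: "vertex set" and v :: vertex where
  start: "(v, {v}) \<in> positions K v"
| move: "q \<in> positions K v \<Longrightarrow> y \<in> legal_moves K q \<Longrightarrow> move_to q y \<in> positions K v"

type_synonym strategy = "position \<Rightarrow> vertex"

text \<open>The values of a strategy at positions that cannot arise, that belong to the opponent, or
  that admit no legal move are unconstrained; they do not influence \<open>win_time\<close> below.\<close>

definition strategies :: "vertex set \<Rightarrow> vertex \<Rightarrow> player \<Rightarrow> strategy set" where
  "strategies K v P = {s. \<forall>q\<in>positions K v.
     to_move q = P \<and> legal_moves K q \<noteq> {} \<longrightarrow> s q \<in> legal_moves K q}"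

text \<open>\<open>play e w v n\<close> is the position after \<open>n\<close> moves when Eve follows \<open>e\<close> and Odin follows \<open>w\<close>.
  It is meaningful only up to the first position without legal moves.\<close>

primrec play :: "strategy \<Rightarrow> strategy \<Rightarrow> vertex \<Rightarrow> nat \<Rightarrow> position" where
  "play e w v 0 = (v, {v})"
| "play e w v (Suc n) =
     (let q = play e w v n
      in move_to q (case to_move q of Eve \<Rightarrow> e q | Odin \<Rightarrow> w q))"

definition stuck_at :: "vertex set \<Rightarrow> strategy \<Rightarrow> strategy \<Rightarrow> vertex \<Rightarrow> nat \<Rightarrow> bool" where
  "stuck_at K e w v n \<longleftrightarrow> legal_moves K (play e w v n) = {}"

text \<open>If the initial vertex is closed, the first player wins at time 0. Otherwise
  Eve wins iff the game ends with Odin to move, and the time is the number of moves made.\<close>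

definition win_time :: "vertex set \<Rightarrow> vertex \<Rightarrow> strategy \<Rightarrow> strategy \<Rightarrow> enat" where
  "win_time K v e w =
     (if v \<in> K then (if to_move (v, {v}) = Eve then 0 else \<infinity>)
      else if \<exists>n. stuck_at K e w v n then
        (let n = (LEAST n. stuck_at K e w v n)
         in if to_move (play e w v n) = Odin then enat n else \<infinity>)
      else \<infinity>)"

definition eve_time :: "vertex set \<Rightarrow> vertex \<Rightarrow> enat" where
  "eve_time K v = (INF e\<in>strategies K v Eve. SUP w\<in>strategies K v Odin. win_time K v e w)"

definition percolation :: "real \<Rightarrow> (vertex \<Rightarrow> bool) measure" where
  "percolation p = PiM {x. odd_vertex x} (\<lambda>_. measure_pmf (bernoulli_pmf p))"

definition closed_set :: "(vertex \<Rightarrow> bool) \<Rightarrow> vertex set" where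
  "closed_set \<omega> = {x. odd_vertex x \<and> \<omega> x}"

end

theory Submission
  imports Defs
begin

text \<open>
  Both bounds come from matchings. If every open odd vertex that Odin can reach has a partner among
  the adjacent even vertices, and different vertices have different partners, then Eve wins by always
  moving to the partner; Odin can follow a matching of the even vertices in the same way. So the
  question is how large a region has to be before the closed odd vertices in it outweigh the
  boundary, and Hall's theorem (\<open>hall_marriage\<close>) reduces this to counting neighbours.

  Upper bound. A finite set of even vertices has more odd neighbours than elements, the excess being
  of the order of its perimeter. In a rotated square of side about \<open>k\<close> the number of closed odd
  vertices is about \<open>p * k\<^sup>2\<close>, which exceeds the perimeter once \<open>k\<close> is a multiple of \<open>1 / p\<close>. With
  \<open>k\<close> of the order of \<open>ln (1 / p) / p\<close> all half rows and half columns of the square contain a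
  closed vertex, with high probability, and this implies Hall's condition for the open odd vertices
  (\<open>region_hall\<close>). Eve then wins before the even vertices of the square are exhausted, that is in
  time of the order of \<open>k\<^sup>2\<close>.

  Lower bound. Sets of even vertices expand: if \<open>S\<close> occupies \<open>h\<close> rows and \<open>w\<close> columns of the rotated
  lattice, it has at least \<open>h + w + 1\<close> more neighbours than elements (\<open>corners_expansion\<close>). Hence Odin
  has a matching near the starting point as soon as no square of side \<open>m\<close> contains more than \<open>m\<close>
  closed vertices, for all \<open>m\<close> up to the size of the neighbourhood (\<open>corners_hall\<close>). For a
  neighbourhood of radius \<open>n\<close> equal to a small multiple of \<open>1 / p\<close> this fails with probability \<open>O(p)\<close>
  (\<open>prob_not_sparse\<close>), and then Odin cannot be stuck during the first \<open>n\<close> moves.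

  The strategies of the definition of \<open>eve_time\<close> enter only through \<open>eve_time_le_iff\<close>, which replaces
  them by backward induction; it also shows that the event in question is measurable.
\<close>

section \<open>Winning within a given number of moves\<close>

text \<open>Backward induction on the number of remaining moves. This replaces the quantification over
strategies, and it is what makes both the measurability of the winning time and the two
strategy arguments accessible by induction.\<close>

primrec eve_wins_within :: "vertex set \<Rightarrow> nat \<Rightarrow> position \<Rightarrow> bool" where
  "eve_wins_within K 0 q \<longleftrightarrow> to_move q = Odin \<and> legal_moves K q = {}"
| "eve_wins_within K (Suc t) q \<longleftrightarrow>
     (case to_move q of
        Odin \<Rightarrow> \<forall>y\<in>legal_moves K q. eve_wins_within K t (move_to q y)
      | Eve \<Rightarrow> \<exists>y\<in>legal_moves K q. eve_wins_within K t (move_to q y))"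

lemma eve_wins_within_mono:
  assumes "eve_wins_within K s q" "s \<le> t"
  shows "eve_wins_within K t q"
proof -
  have "eve_wins_within K (Suc s) q" if "eve_wins_within K s q" for s q
    using that
  proof (induction s arbitrary: q)
    case 0
    then show ?case by simp
  next
    case (Suc s)
    then show ?case
      unfolding eve_wins_within.simps(2)[of K "Suc s"] eve_wins_within.simps(2)[of K s q]
      by (cases "to_move q") (simp_all del: eve_wins_within.simps, blast+)
  qed
  with assms(2,1) show ?thesis
    by (induction rule: dec_induct) auto
qed

definition moves_made :: "position \<Rightarrow> nat" where
  "moves_made q = card (snd q) - 1"

lemma play_positions:
  assumes e: "e \<in> strategies K v Eve" and w: "w \<in> strategies K v Odin"
    and "\<And>m. m < n \<Longrightarrow> \<not> stuck_at K e w v m"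
  shows "play e w v n \<in> positions K v \<and> finite (snd (play e w v n)) \<and> card (snd (play e w v n)) = Suc n"
  using assms(3)
proof (induction n)
  case 0
  then show ?case by (auto intro: positions.start)
next
  case (Suc n)
  let ?q = "play e w v n"
  have q: "?q \<in> positions K v" "finite (snd ?q)" "card (snd ?q) = Suc n"
    using Suc by auto
  have ne: "legal_moves K ?q \<noteq> {}"
    using Suc.prems[of n] by (simp add: stuck_at_def)
  have "(case to_move ?q of Eve \<Rightarrow> e ?q | Odin \<Rightarrow> w ?q) \<in> legal_moves K ?q"
    using e w q(1) ne by (auto simp: strategies_def split: player.split)
  with q show ?case
    by (auto simp: Let_def move_to_def legal_moves_def intro: positions.move[unfolded move_to_def legal_moves_def])
qed

lemma preferring_strategy:
  obtains s where "\<And>q. L q \<noteq> {} \<Longrightarrow> s q \<in> L q" "\<And>q. \<exists>y\<in>L q. P q y \<Longrightarrow> P q (s q)"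
proof -
  have "\<forall>q. \<exists>y. (L q \<noteq> {} \<longrightarrow> y \<in> L q) \<and> ((\<exists>y\<in>L q. P q y) \<longrightarrow> P q y)"
    by blast
  from choice[OF this] show thesis using that by blast
qed

text \<open>The game cut off after \<open>t\<close> moves is finite and hence determined. Each player can read off from
the visited set how many moves remain, so whoever wins the cut-off game has a strategy that
depends on the position alone and keeps the position won; this is how a bound on the \<open>INF\<close>-\<open>SUP\<close>
of the definition turns into backward induction and back.\<close>

lemma eve_time_le_iff:
  assumes "v \<notin> K"
  shows "eve_time K v \<le> enat t \<longleftrightarrow> eve_wins_within K t (v, {v})"
proof
  assume "eve_time K v \<le> enat t"
  then have "eve_time K v < enat (Suc t)"
    by (metis enat_ord_simps(2) le_less_trans lessI)
  then obtain e where e: "e \<in> strategies K v Eve"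
    and lt: "(SUP w\<in>strategies K v Odin. win_time K v e w) < enat (Suc t)"
    unfolding eve_time_def by (auto simp: INF_less_iff)
  show "eve_wins_within K t (v, {v})"
  proof (rule ccontr)
    assume nW: "\<not> eve_wins_within K t (v, {v})"
    \<comment> \<open>Odin moves, whenever possible, to a position from which Eve cannot win in the remaining time.\<close>
    obtain w where
      w1: "\<And>q. legal_moves K q \<noteq> {} \<Longrightarrow> w q \<in> legal_moves K q" and
      w2: "\<And>q. \<exists>y\<in>legal_moves K q. \<not> eve_wins_within K (t - Suc (moves_made q)) (move_to q y) \<Longrightarrow>
            \<not> eve_wins_within K (t - Suc (moves_made q)) (move_to q (w q))"
      using preferring_strategy[of "legal_moves K"
          "\<lambda>q y. \<not> eve_wins_within K (t - Suc (moves_made q)) (move_to q y)"] by auto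
    have w: "w \<in> strategies K v Odin"
      using w1 by (auto simp: strategies_def)
    have inv: "\<not> eve_wins_within K (t - n) (play e w v n)"
      if "n \<le> t" "\<And>m. m < n \<Longrightarrow> \<not> stuck_at K e w v m" for n
      using that
    proof (induction n)
      case 0
      then show ?case using nW by simp
    next
      case (Suc n)
      let ?q = "play e w v n"
      have q: "?q \<in> positions K v" "card (snd ?q) = Suc n"
        using play_positions[OF e w, of n] Suc.prems by auto
      have ne: "legal_moves K ?q \<noteq> {}"
        using Suc.prems(2)[of n] by (simp add: stuck_at_def)
      have tn: "t - n = Suc (t - Suc n)" "moves_made ?q = n"
        using Suc.prems q by (auto simp: moves_made_def)
      have nq: "\<not> eve_wins_within K (Suc (t - Suc n)) ?q"
        using Suc tn by auto
      show ?case
      proof (cases "to_move ?q")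
        case Eve
        then have "e ?q \<in> legal_moves K ?q"
          using e q ne by (auto simp: strategies_def)
        then show ?thesis using nq Eve by (auto simp: Let_def)
      next
        case Odin
        then show ?thesis using nq w2[of ?q] tn by (auto simp: Let_def)
      qed
    qed
    have "win_time K v e w < enat (Suc t)"
      by (rule SUP_lessD[OF lt w])
    then have ex: "\<exists>n. stuck_at K e w v n"
      and L: "(LEAST n. stuck_at K e w v n) < Suc t"
      "to_move (play e w v (LEAST n. stuck_at K e w v n)) = Odin"
      using assms by (auto simp: win_time_def Let_def split: if_splits)
    define n where "n = (LEAST n. stuck_at K e w v n)"
    have st: "stuck_at K e w v n" unfolding n_def using ex by (rule LeastI_ex)
    have "\<not> eve_wins_within K (t - n) (play e w v n)"
      using L(1) by (intro inv) (auto simp: n_def dest: not_less_Least)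
    moreover have "eve_wins_within K (t - n) (play e w v n)"
      using st L(2)[folded n_def] by (cases "t - n") (auto simp: stuck_at_def)
    ultimately show False by simp
  qed
next
  assume W: "eve_wins_within K t (v, {v})"
  \<comment> \<open>Eve moves, whenever possible, to a position won in the remaining time.\<close>
  obtain e where
    e1: "\<And>q. legal_moves K q \<noteq> {} \<Longrightarrow> e q \<in> legal_moves K q" and
    e2: "\<And>q. \<exists>y\<in>legal_moves K q. eve_wins_within K (t - Suc (moves_made q)) (move_to q y) \<Longrightarrow>
          eve_wins_within K (t - Suc (moves_made q)) (move_to q (e q))"
    using preferring_strategy[of "legal_moves K"
        "\<lambda>q y. eve_wins_within K (t - Suc (moves_made q)) (move_to q y)"] by auto
  have e: "e \<in> strategies K v Eve"
    using e1 by (auto simp: strategies_def)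
  have "win_time K v e w \<le> enat t" if w: "w \<in> strategies K v Odin" for w
  proof -
    have inv: "eve_wins_within K (t - n) (play e w v n)"
      if "n \<le> t" "\<And>m. m < n \<Longrightarrow> \<not> stuck_at K e w v m" for n
      using that
    proof (induction n)
      case 0
      then show ?case using W by simp
    next
      case (Suc n)
      let ?q = "play e w v n"
      have q: "?q \<in> positions K v" "card (snd ?q) = Suc n"
        using play_positions[OF e w, of n] Suc.prems by auto
      have ne: "legal_moves K ?q \<noteq> {}"
        using Suc.prems(2)[of n] by (simp add: stuck_at_def)
      have tn: "t - n = Suc (t - Suc n)" "moves_made ?q = n"
        using Suc.prems q by (auto simp: moves_made_def)
      have nq: "eve_wins_within K (Suc (t - Suc n)) ?q"
        using Suc tn by auto
      show ?case
      proof (cases "to_move ?q")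
        case Odin
        then have "w ?q \<in> legal_moves K ?q"
          using w q ne by (auto simp: strategies_def)
        then show ?thesis using nq Odin by (auto simp: Let_def)
      next
        case Eve
        then show ?thesis using nq e2[of ?q] tn by (auto simp: Let_def)
      qed
    qed
    have ex: "\<exists>n\<le>t. stuck_at K e w v n"
    proof (rule ccontr)
      assume no: "\<not> (\<exists>n\<le>t. stuck_at K e w v n)"
      then have "eve_wins_within K (t - t) (play e w v t)"
        by (intro inv) auto
      then show False using no by (auto simp: stuck_at_def)
    qed
    define n where "n = (LEAST n. stuck_at K e w v n)"
    have st: "stuck_at K e w v n" unfolding n_def using ex by (auto intro: LeastI)
    have nt: "n \<le> t" unfolding n_def using ex by (meson Least_le le_trans)
    have "eve_wins_within K (t - n) (play e w v n)"
      using nt by (intro inv) (auto simp: n_def dest: not_less_Least)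
    then have "to_move (play e w v n) = Odin"
      using st by (cases "t - n") (auto simp: stuck_at_def split: player.splits)
    then show ?thesis
      using assms ex nt by (auto simp: win_time_def Let_def n_def[symmetric])
  qed
  then have "(SUP w\<in>strategies K v Odin. win_time K v e w) \<le> enat t"
    by (intro SUP_least) auto
  then show "eve_time K v \<le> enat t"
    unfolding eve_time_def by (intro INF_lower2[OF e])
qed

lemma eve_time_closed:
  assumes "v \<in> K" "odd_vertex v"
  shows "eve_time K v = 0"
proof -
  define e where "e q = (SOME y. y \<in> legal_moves K q)" for q
  have "e \<in> strategies K v Eve"
    by (auto simp: strategies_def e_def some_in_eq)
  moreover have "(SUP w\<in>strategies K v Odin. win_time K v e w) \<le> 0"
    using assms by (intro SUP_least) (auto simp: win_time_def to_move_def)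
  ultimately have "eve_time K v \<le> 0"
    unfolding eve_time_def by (intro INF_lower2)
  then show ?thesis by simp
qed

section \<open>Playing along a matching\<close>

lemma adjacent_iff:
  "adjacent u y \<longleftrightarrow> y \<in> {(fst u + 1, snd u), (fst u - 1, snd u), (fst u, snd u + 1), (fst u, snd u - 1)}"
proof -
  obtain a b c d where "u = (a,b)" "y = (c,d)" by (metis surj_pair)
  then show ?thesis unfolding adjacent_def by auto
qed

lemma adjacent_odd: "adjacent u y \<Longrightarrow> odd_vertex y \<longleftrightarrow> \<not> odd_vertex u"
  by (auto simp: adjacent_iff odd_vertex_def)

lemma adjacent_sym: "adjacent u y \<longleftrightarrow> adjacent y u"
  by (auto simp: adjacent_def)

lemma to_move_odd: "to_move q = Eve \<longleftrightarrow> odd_vertex (fst q)" "to_move q = Odin \<longleftrightarrow> \<not> odd_vertex (fst q)"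
  by (auto simp: to_move_def)

text \<open>Eve answers every move to an odd vertex \<open>z\<close> by moving to its partner \<open>M z\<close>. The partner is
unvisited because an even vertex of \<open>E\<close> is visited only when its odd partner has been visited
before, and the token never leaves \<open>D \<union> E\<close> because all neighbours of \<open>E\<close> lie in \<open>D\<close>. Every move
of Eve uses up an element of \<open>E\<close>, so at some point it is Odin who is stuck.\<close>

lemma eve_wins_by_matching:
  fixes M :: "vertex \<Rightarrow> vertex" and D E K :: "vertex set"
  assumes "finite E"
    and M: "\<And>z. z \<in> D - K \<Longrightarrow> M z \<in> E \<and> adjacent z (M z)" "inj_on M (D - K)"
    and D: "\<And>x y. x \<in> E \<Longrightarrow> adjacent x y \<Longrightarrow> y \<in> D"
    and odd: "\<And>z. z \<in> D \<Longrightarrow> odd_vertex z" "\<And>z. z \<in> K \<Longrightarrow> odd_vertex z"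
    and even: "\<And>x. x \<in> E \<Longrightarrow> \<not> odd_vertex x"
    and y: "y \<in> D - K" "y \<in> V" "\<And>z. z \<in> D - K \<Longrightarrow> M z \<in> V \<Longrightarrow> z \<in> V - {y}"
  shows "eve_wins_within K (2 * card (E - V)) (y, V)"
  using y
proof (induction "card (E - V)" arbitrary: y V)
  case 0
  then have "M y \<in> E - V" using M(1)[of y] by blast
  then show ?case using 0(1) \<open>finite E\<close> by auto
next
  case (Suc c)
  let ?x = "M y" and ?V = "insert (M y) V"
  have x: "?x \<notin> V" "?x \<in> E" "adjacent y ?x" "\<not> odd_vertex ?x" "?x \<notin> K" "odd_vertex y"
    using Suc.prems(1,2) Suc.prems(3)[of y] M(1)[of y] odd even by (blast, blast, blast, blast, blast, blast)
  have c: "2 * card (E - V) = Suc (Suc (2 * c))" using Suc.hyps(2) by auto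
  have "eve_wins_within K (2 * c) (y', insert y' ?V)"
    if y': "adjacent ?x y'" "y' \<notin> ?V" "y' \<notin> K" for y'
  proof -
    have oy': "odd_vertex y'" "y' \<in> D"
      using y' x D odd by auto
    then have "E - insert y' ?V = (E - V) - {?x}"
      using even by auto
    then have "c = card (E - insert y' ?V)"
      using Suc.hyps(2) x \<open>finite E\<close> by simp
    moreover have "z \<in> insert y' ?V - {y'}" if z: "z \<in> D - K" "M z \<in> insert y' ?V" for z
    proof -
      have "M z \<noteq> y'" using oy'(1) M(1)[OF z(1)] even by blast
      then consider "M z = M y" | "M z \<in> V" using z by auto
      then show ?thesis
      proof cases
        case 1
        then have "z = y" using M(2) z Suc.prems(1) by (auto dest: inj_onD)
        then show ?thesis using Suc.prems(2) y' by auto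
      next
        case 2
        then show ?thesis using Suc.prems(3)[OF z(1)] y' by auto
      qed
    qed
    ultimately show ?thesis
      using Suc.hyps(1)[of "insert y' ?V" y'] oy' y' by auto
  qed
  then have "eve_wins_within K (Suc (2 * c)) (move_to (y, V) ?x)"
    using x by (auto simp: to_move_def legal_moves_def move_to_def)
  moreover have "?x \<in> legal_moves K (y, V)"
    using x by (simp add: legal_moves_def)
  ultimately show ?case
    unfolding c eve_wins_within.simps(2)[of K "Suc (2 * c)"]
    using x by (auto simp: to_move_def simp del: eve_wins_within.simps)
qed

text \<open>The distance that one move changes by at most one: it tells for how many more moves the token
is guaranteed to stay where Odin's matching is defined.\<close>

definition l1_dist :: "vertex \<Rightarrow> vertex \<Rightarrow> int" where
  "l1_dist u v = \<bar>fst u - fst v\<bar> + \<bar>snd u - snd v\<bar>"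

text \<open>The mirror image for Odin, who follows a matching of the even vertices near \<open>v\<close> into open odd
vertices. This matching is only defined near \<open>v\<close>, so it protects Odin only while the token cannot
have left the ball, which is why the distance and the remaining time are added up.\<close>

lemma odin_survives_by_matching:
  assumes f: "\<And>x. \<not> odd_vertex x \<Longrightarrow> l1_dist x v \<le> int n \<Longrightarrow> adjacent x (f x) \<and> f x \<notin> K"
    and inj: "inj_on f {x. \<not> odd_vertex x \<and> l1_dist x v \<le> int n}"
    and x: "\<not> odd_vertex x" "l1_dist x v + int t \<le> int n" "x \<in> V"
      "\<And>z. \<not> odd_vertex z \<Longrightarrow> l1_dist z v \<le> int n \<Longrightarrow> f z \<in> V \<Longrightarrow> z \<in> V - {x}"
  shows "\<not> eve_wins_within K t (x, V)"
  using x
proof (induction t arbitrary: x V rule: less_induct)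
  case (less t)
  let ?y = "f x"
  have y: "adjacent x ?y" "?y \<notin> K" "odd_vertex ?y"
    using f[of x] less.prems(1,2) adjacent_odd[of x "f x"] by auto
  have "?y \<notin> V" using less.prems(4)[of x] less.prems by auto
  then have yl: "?y \<in> legal_moves K (x, V)" using y by (auto simp: legal_moves_def)
  show ?case
  proof (cases t)
    case 0
    then show ?thesis using yl less.prems by auto
  next
    case (Suc s)
    have "\<not> eve_wins_within K s (?y, insert ?y V)"
    proof (cases s)
      case 0
      then show ?thesis using y by (auto simp: to_move_odd)
    next
      case s: (Suc r)
      have "\<not> eve_wins_within K r (x', insert x' (insert ?y V))"
        if x': "adjacent ?y x'" "x' \<notin> insert ?y V" for x'
      proof (rule less.IH)
        show "r < t" using Suc s by simp
        show e: "\<not> odd_vertex x'" using x' y adjacent_odd by blast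
        show "l1_dist x' v + int r \<le> int n"
          using less.prems(2) x'(1) y(1) Suc s by (auto simp: l1_dist_def adjacent_def)
        show "x' \<in> insert x' (insert ?y V)" by simp
        fix z assume z: "\<not> odd_vertex z" "l1_dist z v \<le> int n" "f z \<in> insert x' (insert ?y V)"
        have "f z \<noteq> x'" using e f[OF z(1,2)] z(1) adjacent_odd by metis
        then consider "f z = f x" | "f z \<in> V" using z by auto
        then show "z \<in> insert x' (insert ?y V) - {x'}"
        proof cases
          case 1
          then have "z = x" using inj z less.prems by (auto dest: inj_onD)
          then show ?thesis using less.prems(3) x' by auto
        next
          case 2
          then show ?thesis using less.prems(4)[of z] z x' by auto
        qed
      qed
      then show ?thesis using s y
        by (auto simp: to_move_def legal_moves_def move_to_def)
    qed
    then have "\<not> eve_wins_within K s (move_to (x, V) ?y)" by (simp add: move_to_def)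
    then show ?thesis using Suc yl less.prems(1) by (auto simp: to_move_def)
  qed
qed

section \<open>Hall's theorem\<close>

text \<open>Hall's theorem by the argument of Halmos and Vaughan: either some proper nonempty subfamily is
tight, and then it and the rest (with the elements used by it removed) are matched separately; or
every proper subfamily has an element to spare, and then any choice for one index may be fixed.\<close>

lemma hall_marriage:
  fixes A :: "'i \<Rightarrow> 'a set"
  assumes "finite I" "\<And>i. i \<in> I \<Longrightarrow> finite (A i)"
    and "\<And>J. J \<subseteq> I \<Longrightarrow> card J \<le> card (\<Union>(A ` J))"
  shows "\<exists>f. inj_on f I \<and> (\<forall>i\<in>I. f i \<in> A i)"
  using assms
proof (induction "card I" arbitrary: I A rule: less_induct)
  case less
  note fin = less.prems(1,2) and hall = less.prems(3)
  have finU: "finite (\<Union>(A ` J))" if "J \<subseteq> I" for J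
    using that fin by (auto intro: finite_subset)
  show ?case
  proof (cases "I = {}")
    case True
    then show ?thesis by simp
  next
    case False
    then obtain i0 where i0: "i0 \<in> I" by auto
    show ?thesis
    proof (cases "\<exists>J. J \<subset> I \<and> J \<noteq> {} \<and> card J = card (\<Union>(A ` J))")
      case True
      then obtain J where J: "J \<subset> I" "J \<noteq> {}" "card J = card (\<Union>(A ` J))" by auto
      have fJ: "finite J" "finite (I - J)" using J fin by (auto intro: finite_subset)
      have "\<exists>f. inj_on f J \<and> (\<forall>i\<in>J. f i \<in> A i)"
        using J fin psubset_card_mono[OF fin(1) J(1)] fJ
        by (intro less.hyps hall) auto
      then obtain f where f: "inj_on f J" "\<forall>i\<in>J. f i \<in> A i" by auto
      let ?U = "\<Union>(A ` J)"
      let ?B = "\<lambda>i. A i - ?U"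
      have "\<exists>g. inj_on g (I - J) \<and> (\<forall>i\<in>I-J. g i \<in> ?B i)"
      proof (intro less.hyps)
        show "card (I - J) < card I"
          using J fin by (intro psubset_card_mono) auto
        fix L assume L: "L \<subseteq> I - J"
        have fL: "finite L" using L fJ by (auto intro: finite_subset)
        have "card L + card J = card (L \<union> J)"
          using L fL fJ by (intro card_Un_disjoint[symmetric]) auto
        also have "\<dots> \<le> card (\<Union>(A ` (L \<union> J)))"
          using L J by (intro hall) auto
        also have "\<Union>(A ` (L \<union> J)) = \<Union>(?B ` L) \<union> ?U" by auto
        also have "card \<dots> = card (\<Union>(?B ` L)) + card ?U"
          using L J finU[of L] finU[of J] by (intro card_Un_disjoint) (auto intro: finite_subset)
        finally show "card L \<le> card (\<Union>(?B ` L))" using J by simp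
      qed (use fJ fin in auto)
      then obtain g where g: "inj_on g (I - J)" "\<forall>i\<in>I-J. g i \<in> ?B i" by auto
      let ?h = "\<lambda>i. if i \<in> J then f i else g i"
      have "inj_on ?h I"
      proof (rule inj_onI)
        fix x y assume *: "x \<in> I" "y \<in> I" "?h x = ?h y"
        show "x = y"
        proof (cases "x \<in> J"; cases "y \<in> J")
          assume "x \<in> J" "y \<in> J"
          then show ?thesis using * f by (auto dest: inj_onD)
        next
          assume "x \<notin> J" "y \<notin> J"
          then show ?thesis using * g by (auto dest: inj_onD)
        next
          assume xy: "x \<in> J" "y \<notin> J"
          then have "f x \<in> ?U" using f by blast
          moreover have "g y \<notin> ?U" using g xy * by blast
          ultimately show ?thesis using xy * by auto
        next
          assume xy: "x \<notin> J" "y \<in> J"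
          then have "f y \<in> ?U" using f by blast
          moreover have "g x \<notin> ?U" using g xy * by blast
          ultimately show ?thesis using xy * by auto
        qed
      qed
      moreover have "\<forall>i\<in>I. ?h i \<in> A i" using f g by auto
      ultimately show ?thesis by blast
    next
      case False
      have strict: "card J < card (\<Union>(A ` J))" if "J \<subset> I" "J \<noteq> {}" for J
        using False hall[of J] that by (auto simp: order.strict_iff_order)
      have "card {i0} \<le> card (\<Union>(A ` {i0}))" using i0 by (intro hall) auto
      then have "A i0 \<noteq> {}" by auto
      then obtain a where a: "a \<in> A i0" by auto
      have "\<exists>g. inj_on g (I - {i0}) \<and> (\<forall>i\<in>I-{i0}. g i \<in> A i - {a})"
      proof (intro less.hyps)
        show "card (I - {i0}) < card I" using i0 fin by (meson card_Diff1_less)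
        fix L assume L: "L \<subseteq> I - {i0}"
        show "card L \<le> card (\<Union>i\<in>L. A i - {a})"
        proof (cases "L = {}")
          case False
          then have "card L < card (\<Union>(A ` L))" using L i0 by (intro strict) auto
          moreover have "(\<Union>i\<in>L. A i - {a}) = \<Union>(A ` L) - {a}" by auto
          ultimately show ?thesis using card_Diff1_le[of "\<Union>(A ` L)" a] finU[of L] L
            by (cases "a \<in> \<Union>(A ` L)") (auto simp: card_Diff_singleton)
        qed simp
      qed (use fin in auto)
      then obtain g where g: "inj_on g (I - {i0})" "\<forall>i\<in>I-{i0}. g i \<in> A i - {a}" by auto
      have "inj_on (g(i0 := a)) I"
        using g by (auto simp: inj_on_def)
      moreover have "\<forall>i\<in>I. (g(i0 := a)) i \<in> A i" using g a by auto
      ultimately show ?thesis by blast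
    qed
  qed
qed

section \<open>Expansion of sets of cells\<close>

definition shift :: "int \<times> int \<Rightarrow> (int \<times> int) set \<Rightarrow> (int \<times> int) set" where
  "shift d S = (\<lambda>s. (fst s + fst d, snd s + snd d)) ` S"

text \<open>Every nonempty row contributes the element just beyond its right end.\<close>

lemma card_shift_right:
  assumes "finite S"
  shows "card S + card (fst ` S) \<le> card (S \<union> shift (0, 1) S)"
proof -
  define top where "top i = (i, Max {j. (i, j) \<in> S} + 1)" for i
  have fin: "finite {j. (i, j) \<in> S}" for i
    using finite_imageI[OF assms, of snd] by (rule finite_subset[rotated]) force
  have top: "top i \<in> shift (0, 1) S - S" if "i \<in> fst ` S" for i
  proof -
    have ne: "{j. (i, j) \<in> S} \<noteq> {}" using that by force
    have "Max {j. (i, j) \<in> S} \<in> {j. (i, j) \<in> S}" using Max_in[OF fin ne] .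
    moreover have "(i, Max {j. (i, j) \<in> S} + 1) \<notin> S"
      using Max_ge[OF fin, of "Max {j. (i, j) \<in> S} + 1" i] by auto
    ultimately show ?thesis by (force simp: top_def shift_def)
  qed
  have fs: "finite (shift (0, 1) S)" using assms by (simp add: shift_def)
  have "card (fst ` S) = card (top ` fst ` S)"
    by (intro card_image[symmetric]) (auto simp: inj_on_def top_def)
  also have "\<dots> \<le> card (shift (0, 1) S - S)"
    using fs by (intro card_mono image_subsetI top) auto
  finally have "card (fst ` S) \<le> card (shift (0, 1) S - S)" .
  moreover have "card (S \<union> shift (0, 1) S) = card S + card (shift (0, 1) S - S)"
    using assms fs by (metis Diff_disjoint Un_Diff_cancel card_Un_disjoint finite_Diff)
  ultimately show ?thesis by simp
qed

lemma card_shift_up: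
  assumes "finite S"
  shows "card S + card (snd ` S) \<le> card (S \<union> shift (1, 0) S)"
proof -
  let ?T = "prod.swap ` S"
  have "card ?T + card (fst ` ?T) \<le> card (?T \<union> shift (0, 1) ?T)"
    using assms by (intro card_shift_right) auto
  moreover have "card ?T = card S" by (intro card_image) auto
  moreover have "fst ` ?T = snd ` S" by force
  moreover have "?T \<union> shift (0, 1) ?T = prod.swap ` (S \<union> shift (1, 0) S)"
    by (auto simp: shift_def image_Un image_image)
  moreover have "card (prod.swap ` (S \<union> shift (1, 0) S)) = card (S \<union> shift (1, 0) S)"
    by (intro card_image) auto
  ultimately show ?thesis by simp
qed

text \<open>In rotated coordinates the even and the odd vertices each form a copy of the integer grid, and
the four neighbours of an even vertex are the corners of the unit cell that it represents.\<close>

definition corners :: "int \<times> int \<Rightarrow> (int \<times> int) set" where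
  "corners s = {fst s, fst s + 1} \<times> {snd s, snd s + 1}"

text \<open>The isoperimetric inequality behind Odin's strategy. The corners arise from two successive unit
shifts, each of which gains one element per line in the direction of the shift; the second one
gains one more than the number of columns of \<open>S\<close> because the first shift has widened the set.\<close>

lemma corners_expansion:
  assumes "finite S" "S \<noteq> {}"
  shows "card S + card (fst ` S) + card (snd ` S) + 1 \<le> card (\<Union>(corners ` S))"
proof -
  let ?T = "S \<union> shift (0, 1) S"
  have fT: "finite ?T" using assms by (simp add: shift_def)
  have "snd ` ?T = (snd ` S) \<union> (\<lambda>j. j + 1) ` snd ` S"
    by (auto simp: shift_def image_Un image_image)
  have M: "Max (snd ` S) \<in> snd ` S" using assms by (intro Max_in) auto
  have "Max (snd ` S) + 1 \<notin> snd ` S"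
    using assms by (metis Max_ge finite_imageI not_less less_add_one)
  then have "card (insert (Max (snd ` S) + 1) (snd ` S)) = Suc (card (snd ` S))"
    using assms by simp
  moreover have "insert (Max (snd ` S) + 1) (snd ` S) \<subseteq> snd ` ?T"
    unfolding \<open>snd ` ?T = _\<close> using M by auto
  ultimately have "Suc (card (snd ` S)) \<le> card (snd ` ?T)"
    using fT by (metis card_mono finite_imageI)
  moreover have "\<Union>(corners ` S) = ?T \<union> shift (1, 0) ?T"
    by (auto simp: corners_def shift_def image_Un image_image)
  ultimately show ?thesis
    using card_shift_right[OF assms(1)] card_shift_up[OF fT] by simp
qed

lemma card_of_gapless:
  fixes A :: "int set"
  assumes "finite A" "A \<noteq> {}"
    and "\<And>c. c \<notin> A \<Longrightarrow> (\<forall>a\<in>A. a < c) \<or> (\<forall>a\<in>A. c < a)"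
  shows "A = {Min A..<Min A + int (card A)}"
proof -
  define l h where "l = Min A" and "h = Max A"
  have lh: "l \<in> A" "h \<in> A" using assms by (auto simp: l_def h_def)
  then have "l \<le> h" using assms by (auto simp: h_def)
  have A: "A = {l..h}"
  proof (intro equalityI subsetI)
    fix c assume c: "c \<in> {l..h}"
    show "c \<in> A"
      using assms(3)[of c] c lh by fastforce
  qed (use assms in \<open>auto simp: l_def h_def\<close>)
  then have "card A = nat (h - l + 1)" by simp
  then show ?thesis
    unfolding l_def[symmetric] using A \<open>l \<le> h\<close> by auto
qed

text \<open>Hall's condition for matching cells to corners outside \<open>C\<close>. If a row or a column separates \<open>S\<close>
into two parts then their corners are disjoint and induction applies to each part. Otherwise \<open>S\<close> meets an interval of rows and an interval of columns, hence
its corners lie in a square of side \<open>m = max h w + 1\<close>, where \<open>h\<close> and \<open>w\<close> are the numbers of rows and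
columns. The surplus \<open>h + w + 1 \<ge> m + 1\<close> of the isoperimetric inequality pays for the at most
\<open>m + 1\<close> elements of \<open>C\<close> in that square. The set \<open>G\<close> limits the squares to be inspected to
those that meet the region of interest.\<close>

lemma corners_hall:
  fixes C :: "(int \<times> int) set"
  assumes box: "\<And>m i j. 2 \<le> m \<Longrightarrow> m \<le> M \<Longrightarrow> {i..<i + int m} \<times> {j..<j + int m} \<inter> G \<noteq> {} \<Longrightarrow>
       card (C \<inter> {i..<i + int m} \<times> {j..<j + int m}) \<le> Suc m"
    and S: "finite S" "S \<subseteq> G" "\<And>A. A = fst ` S \<or> A = snd ` S \<Longrightarrow> card A < M"
  shows "card S \<le> card (\<Union>(corners ` S) - C)"
  using S
proof (induction "card S" arbitrary: S rule: less_induct)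
  case less
  have finN: "finite (\<Union>(corners ` S))" if "finite S" for S
    using that by (auto simp: corners_def)
  have split: "card S \<le> card (\<Union>(corners ` S) - C)"
    if P: "\<exists>s\<in>S. P s" "\<exists>s\<in>S. \<not> P s"
      "\<And>s t. s \<in> S \<Longrightarrow> t \<in> S \<Longrightarrow> P s \<Longrightarrow> \<not> P t \<Longrightarrow> corners s \<inter> corners t = {}" for P
  proof -
    let ?A = "{s\<in>S. P s}" and ?B = "{s\<in>S. \<not> P s}"
    have *: "card T \<le> card (\<Union>(corners ` T) - C)" if "T \<subset> S" for T
    proof (rule less.hyps)
      show "card T < card S" using that less.prems by (intro psubset_card_mono)
      show "finite T" "T \<subseteq> G" using that less.prems by (auto intro: finite_subset)
      fix A assume "A = fst ` T \<or> A = snd ` T"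
      then show "card A < M"
        using less.prems(1) less.prems(3)[of "fst ` S"] less.prems(3)[of "snd ` S"] that
          card_mono[of "fst ` S" "fst ` T"] card_mono[of "snd ` S" "snd ` T"]
        by (metis finite_imageI image_mono le_less_trans less_imp_le psubset_imp_subset)
    qed
    have SS: "S = ?A \<union> ?B" by auto
    have "card S = card ?A + card ?B"
      using less.prems by (subst SS, intro card_Un_disjoint) auto
    also have "\<dots> \<le> card (\<Union>(corners ` ?A) - C) + card (\<Union>(corners ` ?B) - C)"
      using P by (intro add_mono *) auto
    also have "\<dots> = card ((\<Union>(corners ` ?A) - C) \<union> (\<Union>(corners ` ?B) - C))"
      using P(3) finN[of ?A] finN[of ?B] less.prems(1)
      by (intro card_Un_disjoint[symmetric] finite_Diff) fastforce+
    also have "(\<Union>(corners ` ?A) - C) \<union> (\<Union>(corners ` ?B) - C) = \<Union>(corners ` S) - C"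
      by auto
    finally show ?thesis .
  qed
  show ?case
  proof (cases "S = {}")
    case True
    then show ?thesis by simp
  next
    case False
    consider (row) c where "c \<notin> fst ` S" "\<exists>a\<in>S. fst a < c" "\<exists>a\<in>S. c < fst a"
      | (col) c where "c \<notin> snd ` S" "\<exists>a\<in>S. snd a < c" "\<exists>a\<in>S. c < snd a"
      | (box) "\<And>c. c \<notin> fst ` S \<Longrightarrow> (\<forall>a\<in>fst ` S. a < c) \<or> (\<forall>a\<in>fst ` S. c < a)"
         "\<And>c. c \<notin> snd ` S \<Longrightarrow> (\<forall>a\<in>snd ` S. a < c) \<or> (\<forall>a\<in>snd ` S. c < a)"
      by (smt (verit, best) image_iff linorder_neqE)
    then show ?thesis
    proof cases
      case row
      then show ?thesis
        by (intro split[of "\<lambda>s. fst s < c"]) (force simp: corners_def)+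
    next
      case col
      then show ?thesis
        by (intro split[of "\<lambda>s. snd s < c"]) (force simp: corners_def)+
    next
      case box
      let ?h = "card (fst ` S)" and ?w = "card (snd ` S)"
      define m where "m = Suc (max ?h ?w)"
      define i where "i = Min (fst ` S)"
      define j where "j = Min (snd ` S)"
      have I: "fst ` S = {i..<i + int ?h}" and J: "snd ` S = {j..<j + int ?w}"
        unfolding i_def j_def using box less.prems False by (intro card_of_gapless; simp)+
      have hw: "1 \<le> ?h" "1 \<le> ?w" using False less.prems(1) by (simp_all add: Suc_leI card_gt_0_iff)
      let ?B = "{i..<i + int m} \<times> {j..<j + int m}"
      have mem: "i \<le> fst s \<and> fst s + 1 < i + int m \<and> j \<le> snd s \<and> snd s + 1 < j + int m"
        if "s \<in> S" for s
      proof -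
        have "fst s \<in> {i..<i + int ?h}" "snd s \<in> {j..<j + int ?w}"
          using I J that by (metis imageI)+
        then show ?thesis by (auto simp: m_def)
      qed
      have SB: "S \<subseteq> ?B"
      proof
        fix s assume "s \<in> S"
        from mem[OF this] show "s \<in> ?B" by (cases s) auto
      qed
      have NB: "\<Union>(corners ` S) \<subseteq> ?B"
      proof
        fix x assume "x \<in> \<Union>(corners ` S)"
        then obtain s where s: "s \<in> S" "x \<in> corners s" by blast
        show "x \<in> ?B" using mem[OF s(1)] s(2) by (auto simp: corners_def mem_Times_iff)
      qed
      have "?B \<inter> G \<noteq> {}" using SB False less.prems(2) by auto
      then have "card (C \<inter> ?B) \<le> Suc m"
        using less.prems(3)[of "fst ` S"] less.prems(3)[of "snd ` S"] hw
        by (intro assms(1)) (auto simp: m_def)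
      moreover have "card (\<Union>(corners ` S)) \<le> card (\<Union>(corners ` S) - C) + card (C \<inter> ?B)"
      proof -
        have "card (\<Union>(corners ` S)) \<le> card ((\<Union>(corners ` S) - C) \<union> (C \<inter> ?B))"
          using NB finN[OF less.prems(1)] by (intro card_mono) (auto intro: finite_subset)
        also have "\<dots> \<le> card (\<Union>(corners ` S) - C) + card (C \<inter> ?B)" by (rule card_Un_le)
        finally show ?thesis .
      qed
      ultimately show ?thesis
        using corners_expansion[OF less.prems(1) False] hw by (simp add: m_def)
    qed
  qed
qed

section \<open>Rectangles with many closed vertices\<close>

text \<open>The vertices of a path with \<open>n\<close> vertices against its \<open>n - 1\<close> edges: given a hole \<open>z\<close> in \<open>A\<close>, the
vertices on either side of it choose the edge pointing towards \<open>z\<close>.\<close>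

lemma card_path_neighbours:
  fixes A :: "nat set"
  assumes "A \<subset> {..<n}"
  shows "card A \<le> card {b. Suc b < n \<and> (b \<in> A \<or> Suc b \<in> A)}"
proof -
  obtain z where z: "z < n" "z \<notin> A" using assms by auto
  let ?g = "\<lambda>b. if b < z then b else b - 1"
  have "inj_on ?g A"
  proof (rule inj_onI)
    fix x y assume "x \<in> A" "y \<in> A" "?g x = ?g y"
    then show "x = y" using z by (cases "x = z"; cases "y = z") (auto split: if_splits)
  qed
  then have "card A = card (?g ` A)" by (rule card_image[symmetric])
  also have "\<dots> \<le> card {b. Suc b < n \<and> (b \<in> A \<or> Suc b \<in> A)}"
  proof (intro card_mono subsetI)
    fix c assume "c \<in> ?g ` A"
    then obtain b where b: "b \<in> A" "c = ?g b" by auto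
    then have "b < n" "b \<noteq> z" using assms z by auto
    then show "c \<in> {b. Suc b < n \<and> (b \<in> A \<or> Suc b \<in> A)}"
      using b z by (cases "b < z") auto
  qed (rule finite_subset[of _ "{..<n}"], auto)
  finally show ?thesis .
qed

text \<open>An element of \<open>R k \<inter> L\<close> that is missing from some earlier \<open>R a\<close> must enter the sequence between
\<open>a\<close> and \<open>k\<close>, and it is counted as a new element at that moment.\<close>

lemma sum_card_with_new_elements:
  fixes R :: "nat \<Rightarrow> 'a set"
  assumes "\<And>a. finite (R a)" and "\<And>b. b \<in> R k \<inter> L \<Longrightarrow> \<exists>a<k. b \<notin> R a"
  shows "card (R k \<inter> L) + (\<Sum>a<k. card (R a)) \<le> (\<Sum>a<k. card (R a \<union> (R (Suc a) \<inter> L)))"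
proof -
  have sub: "R k \<inter> L \<subseteq> (\<Union>a<k. (R (Suc a) \<inter> L) - R a)"
  proof
    fix b assume b: "b \<in> R k \<inter> L"
    then obtain a where a: "a < k" "b \<notin> R a" using assms by auto
    from a b have "\<exists>c. a \<le> c \<and> c < k \<and> b \<notin> R c \<and> b \<in> R (Suc c)"
    proof (induction "k - a" arbitrary: a)
      case (Suc d)
      then show ?case
        by (cases "b \<in> R (Suc a)") (fastforce, metis Diff_iff IntE Suc_diff_Suc Suc_inject Suc_leD Suc_lessI)
    qed simp
    then show "b \<in> (\<Union>a<k. (R (Suc a) \<inter> L) - R a)" using b by auto
  qed
  have "card (R k \<inter> L) \<le> card (\<Union>a<k. (R (Suc a) \<inter> L) - R a)"
    using sub assms by (intro card_mono) auto
  also have "\<dots> \<le> (\<Sum>a<k. card ((R (Suc a) \<inter> L) - R a))"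
    by (rule card_UN_le) simp
  finally have "card (R k \<inter> L) \<le> (\<Sum>a<k. card ((R (Suc a) \<inter> L) - R a))" .
  moreover have "card (R a \<union> (R (Suc a) \<inter> L)) = card (R a) + card ((R (Suc a) \<inter> L) - R a)" for a
    using assms(1) by (metis Diff_disjoint Un_Diff_cancel card_Un_disjoint finite_Diff finite_Int)
  ultimately show ?thesis by (simp add: sum.distrib)
qed

text \<open>The pattern of closed odd vertices, in a grid of \<open>2 * k + 1\<close> rows and \<open>2 * k\<close> columns, from which
Eve's matching is built. The middle row \<open>k\<close> and the middle of the columns cut the grid into four
\<open>k\<close> by \<open>k\<close> blocks; in two opposite blocks every row is required to contain a closed vertex, in
the other two every column.\<close>

definition crossing_closed :: "nat \<Rightarrow> (nat \<times> nat) set \<Rightarrow> bool" where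
  "crossing_closed k C \<longleftrightarrow>
     (\<forall>b<k. \<exists>a<k. (a, b) \<in> C) \<and>
     (\<forall>a<k. \<exists>b\<in>{k..<2*k}. (a, b) \<in> C) \<and>
     (\<forall>a\<in>{k<..2*k}. \<exists>b<k. (a, b) \<in> C) \<and>
     (\<forall>b\<in>{k..<2*k}. \<exists>a\<in>{k<..2*k}. (a, b) \<in> C)"

text \<open>Hall's condition for matching the open vertices of the grid into its cells. Writing \<open>R a\<close> for row
\<open>a\<close> of \<open>S\<close>, the cells between rows \<open>a\<close> and \<open>a + 1\<close> that touch \<open>S\<close> are at least as many as any set of
positions occurring in these two rows, provided this set is not a full row. Below the middle row
the set is \<open>R a\<close> together with the left half of \<open>R (a + 1)\<close>, which is not full because row \<open>a\<close> has
a closed vertex on the right; above it, \<open>R (a + 1)\<close> together with the right half of \<open>R a\<close>. This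
accounts for all rows but the middle one. The left half of the middle row is recovered from the
positions that are new in the left half of some row \<open>a + 1 \<le> k\<close>, since every left column contains
a closed vertex below the middle; the right half is recovered symmetrically from above.\<close>

lemma region_hall:
  assumes cc: "crossing_closed k C"
    and S: "S \<subseteq> {..2*k} \<times> {..<2*k} - C"
  shows "card S \<le> card {(a, b). a < 2*k \<and> Suc b < 2*k \<and>
            ((a, b) \<in> S \<or> (Suc a, b) \<in> S \<or> (a, Suc b) \<in> S \<or> (Suc a, Suc b) \<in> S)}"
    (is "_ \<le> card ?N")
proof -
  define R where "R a = {b. (a, b) \<in> S}" for a
  define N where "N a = {b. Suc b < 2*k \<and> (b \<in> R a \<union> R (Suc a) \<or> Suc b \<in> R a \<union> R (Suc a))}" for a
  let ?L = "{..<k}" and ?R = "{k..<2*k}"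
  have R: "R a \<subseteq> {..<2*k}" for a using S by (auto simp: R_def)
  have finR: "finite (R a)" for a using R[of a] by (rule finite_subset) simp
  have finN: "finite (N a)" for a by (rule finite_subset[of _ "{..<2*k}"]) (auto simp: N_def)
  have notR: "b \<notin> R a" if "(a, b) \<in> C" for a b using that S by (auto simp: R_def)
  have le: "card A \<le> card (N a)" if "A \<subseteq> R a \<union> R (Suc a)" "A \<noteq> {..<2*k}" for A a
  proof -
    have "A \<subset> {..<2*k}" using that R[of a] R[of "Suc a"] by auto
    then have "card A \<le> card {b. Suc b < 2*k \<and> (b \<in> A \<or> Suc b \<in> A)}"
      by (rule card_path_neighbours)
    also have "\<dots> \<le> card (N a)" using that(1) finN by (intro card_mono) (auto simp: N_def)
    finally show ?thesis .
  qed
  have "card S = (\<Sum>a\<le>2*k. card (R a))"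
  proof -
    have "S = (SIGMA a:{..2*k}. R a)" using S by (auto simp: R_def)
    then show ?thesis using finR by simp
  qed
  also have "{..2*k} = {..<k} \<union> {k} \<union> {k<..2*k}" by auto
  also have "(\<Sum>a\<in>{..<k} \<union> {k} \<union> {k<..2*k}. card (R a)) =
      (\<Sum>a<k. card (R a)) + card (R k) + (\<Sum>a\<in>{k<..2*k}. card (R a))"
    by (subst sum.union_disjoint; (subst sum.union_disjoint)?) auto
  also have "card (R k) = card (R k \<inter> ?L) + card (R k \<inter> ?R)"
  proof -
    have "R k = (R k \<inter> ?L) \<union> (R k \<inter> ?R)" using R[of k] by auto
    then show ?thesis using finR by (metis card_Un_disjoint finite_Int Int_assoc Int_empty_right ivl_disj_int_one(2) inf_left_commute)
  qed
  also have "(\<Sum>a\<in>{k<..2*k}. card (R a)) = (\<Sum>a<k. card (R (2*k - a)))"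
    by (rule sum.reindex_bij_witness[of _ "\<lambda>a. 2*k - a" "\<lambda>a. 2*k - a"]) auto
  finally have "card S = (card (R k \<inter> ?L) + (\<Sum>a<k. card (R a))) +
      (card (R k \<inter> ?R) + (\<Sum>a<k. card (R (2*k - a))))" by simp
  moreover have "card (R k \<inter> ?L) + (\<Sum>a<k. card (R a)) \<le> (\<Sum>a<k. card (R a \<union> (R (Suc a) \<inter> ?L)))"
  proof (rule sum_card_with_new_elements[OF finR])
    fix b assume "b \<in> R k \<inter> ?L"
    then obtain a where "a < k" "(a, b) \<in> C" using cc by (auto simp: crossing_closed_def)
    then show "\<exists>a<k. b \<notin> R a" using notR by blast
  qed
  moreover have "(\<Sum>a<k. card (R a \<union> (R (Suc a) \<inter> ?L))) \<le> (\<Sum>a<k. card (N a))"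
  proof (intro sum_mono le)
    fix a assume "a \<in> {..<k}"
    then obtain b where "b \<in> {k..<2*k}" "(a, b) \<in> C" using cc by (auto simp: crossing_closed_def)
    then have "b \<notin> R a \<union> (R (Suc a) \<inter> ?L)" "b < 2*k" using notR by auto
    then show "R a \<union> (R (Suc a) \<inter> ?L) \<noteq> {..<2*k}" by auto
  qed auto
  moreover have "card (R k \<inter> ?R) + (\<Sum>a<k. card (R (2*k - a))) \<le>
      (\<Sum>a<k. card (R (2*k - a) \<union> (R (2*k - Suc a) \<inter> ?R)))"
  proof -
    have "card (R (2*k - k) \<inter> ?R) + (\<Sum>a<k. card (R (2*k - a))) \<le>
      (\<Sum>a<k. card (R (2*k - a) \<union> (R (2*k - Suc a) \<inter> ?R)))"
    proof (rule sum_card_with_new_elements[of "\<lambda>a. R (2*k - a)" k ?R, OF finR])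
      fix b assume "b \<in> R (2*k - k) \<inter> ?R"
      then have "b \<in> {k..<2*k}" by simp
      then obtain a where "a \<in> {k<..2*k}" "(a, b) \<in> C" using cc unfolding crossing_closed_def by blast
      then have "2*k - a < k" "b \<notin> R (2*k - (2*k - a))" using notR by auto
      then show "\<exists>a<k. b \<notin> R (2*k - a)" by blast
    qed
    then show ?thesis by simp
  qed
  moreover have "(\<Sum>a<k. card (R (2*k - a) \<union> (R (2*k - Suc a) \<inter> ?R))) \<le> (\<Sum>a<k. card (N (2*k - Suc a)))"
  proof (intro sum_mono le)
    fix a assume a: "a \<in> {..<k}"
    then have "2*k - a \<in> {k<..2*k}" by auto
    then obtain b where "b < k" "(2*k - a, b) \<in> C" using cc unfolding crossing_closed_def by blast
    then have "b \<notin> R (2*k - a) \<union> (R (2*k - Suc a) \<inter> ?R)" "b < 2*k" using notR by auto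
    then show "R (2*k - a) \<union> (R (2*k - Suc a) \<inter> ?R) \<noteq> {..<2*k}" by (metis lessThan_iff)
    have "Suc (2*k - Suc a) = 2*k - a" using a by auto
    then show "R (2*k - a) \<union> (R (2*k - Suc a) \<inter> ?R) \<subseteq> R (2*k - Suc a) \<union> R (Suc (2*k - Suc a))"
      by auto
  qed
  moreover have "(\<Sum>a<k. card (N (2*k - Suc a))) = (\<Sum>a\<in>{k..<2*k}. card (N a))"
    by (rule sum.reindex_bij_witness[of _ "\<lambda>a. 2*k - Suc a" "\<lambda>a. 2*k - Suc a"]) auto
  moreover have "(\<Sum>a<k. card (N a)) + (\<Sum>a\<in>{k..<2*k}. card (N a)) = (\<Sum>a<2*k. card (N a))"
    by (subst sum.union_disjoint[symmetric]) (auto intro: sum.cong)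
  moreover have "(\<Sum>a<2*k. card (N a)) = card ?N"
  proof -
    have "?N = (SIGMA a:{..<2*k}. N a)" by (auto simp: N_def R_def)
    then show ?thesis using finN by simp
  qed
  ultimately show ?thesis by linarith
qed

text \<open>The \<open>4 * k\<close> half rows and half columns that have to contain a closed vertex; they all have \<open>k\<close> elements, which
makes the pattern accessible to a union bound.\<close>

definition crossing_blocks :: "nat \<Rightarrow> (nat \<times> nat) set set" where
  "crossing_blocks k =
     (\<lambda>b. {..<k} \<times> {b}) ` {..<k} \<union> (\<lambda>a. {a} \<times> {k..<2*k}) ` {..<k} \<union>
     (\<lambda>a. {a} \<times> {..<k}) ` {k<..2*k} \<union> (\<lambda>b. {k<..2*k} \<times> {b}) ` {k..<2*k}"

lemma crossing_closed_iff_blocks: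
  "crossing_closed k C \<longleftrightarrow> (\<forall>A\<in>crossing_blocks k. A \<inter> C \<noteq> {})"
proof -
  have *: "({a} \<times> B) \<inter> C \<noteq> {} \<longleftrightarrow> (\<exists>b\<in>B. (a, b) \<in> C)" "(B \<times> {a}) \<inter> C \<noteq> {} \<longleftrightarrow> (\<exists>b\<in>B. (b, a) \<in> C)"
    for a B by auto
  show ?thesis
    unfolding crossing_closed_def crossing_blocks_def ball_Un Set.ball_simps(9) * by (simp add: Ball_def Bex_def)
qed

lemma crossing_blocks_block:
  assumes "A \<in> crossing_blocks k"
  shows "finite A" "card A = k" "A \<subseteq> {..2*k} \<times> {..<2*k}"
  using assms by (auto simp: crossing_blocks_def card_cartesian_product)

lemma card_crossing_blocks: "finite (crossing_blocks k)" "card (crossing_blocks k) \<le> 4 * k"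
proof -
  show "finite (crossing_blocks k)" by (simp add: crossing_blocks_def)
  have img: "card (f ` B) \<le> card B" if "finite B" for f :: "nat \<Rightarrow> (nat \<times> nat) set" and B
    by (rule card_image_le[OF that])
  let ?A = "(\<lambda>b. {..<k} \<times> {b}) ` {..<k}" and ?B = "(\<lambda>a. {a} \<times> {k..<2*k}) ` {..<k}"
    and ?C = "(\<lambda>a. {a} \<times> {..<k}) ` {k<..2*k}" and ?D = "(\<lambda>b. {k<..2*k} \<times> {b}) ` {k..<2*k}"
  have "card ?A \<le> k" "card ?B \<le> k" "card ?C \<le> k" "card ?D \<le> k"
    by (rule order.trans[OF img]; simp)+
  then show "card (crossing_blocks k) \<le> 4 * k"
    unfolding crossing_blocks_def
    using card_Un_le[of "?A \<union> ?B \<union> ?C" ?D] card_Un_le[of "?A \<union> ?B" ?C] card_Un_le[of ?A ?B]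
    by linarith
qed

section \<open>Rotated coordinates\<close>

text \<open>With \<open>c\<close> odd, these two maps enumerate the odd and the even vertices, such
that the neighbours of an even vertex are the odd vertices at the corners of its cell.\<close>

definition odd_at :: "vertex \<Rightarrow> int \<times> int \<Rightarrow> vertex" where
  "odd_at c s = (fst c + fst s + snd s, snd c + fst s - snd s)"

definition even_at :: "vertex \<Rightarrow> int \<times> int \<Rightarrow> vertex" where
  "even_at c s = (fst c + fst s + snd s + 1, snd c + fst s - snd s)"

lemma odd_at_odd: "odd_vertex c \<Longrightarrow> odd_vertex (odd_at c s)"
  by (simp add: odd_at_def odd_vertex_def)

lemma even_at_even: "odd_vertex c \<Longrightarrow> \<not> odd_vertex (even_at c s)"
  by (simp add: even_at_def odd_vertex_def)

lemma inj_odd_at: "inj (odd_at c)"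
proof (rule injI)
  fix s t assume "odd_at c s = odd_at c t"
  then have "fst s + snd s = fst t + snd t" "fst s - snd s = fst t - snd t"
    by (simp_all add: odd_at_def algebra_simps)
  then show "s = t" by (intro prod_eqI) linarith+
qed

lemma inj_even_at: "inj (even_at c)"
proof (rule injI)
  fix s t assume "even_at c s = even_at c t"
  then have "fst s + snd s = fst t + snd t" "fst s - snd s = fst t - snd t"
    by (simp_all add: even_at_def algebra_simps)
  then show "s = t" by (intro prod_eqI) linarith+
qed

lemma even_at_coordinates:
  assumes "odd_vertex c" "\<not> odd_vertex z"
  obtains s where "z = even_at c s"
proof
  define u d where "u = fst z - fst c - 1" and "d = snd z - snd c"
  have "even (u + d)" using assms by (simp add: odd_vertex_def u_def d_def)
  then have "u = (u + d) div 2 + (u - d) div 2" "d = (u + d) div 2 - (u - d) div 2"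
    by presburger+
  then show "z = even_at c ((u + d) div 2, (u - d) div 2)"
    by (intro prod_eqI) (simp_all add: even_at_def u_def d_def)
qed

lemma adjacent_even_at:
  "adjacent (even_at c s) y \<longleftrightarrow> y \<in> odd_at c ` corners s"
  by (auto simp: adjacent_iff even_at_def odd_at_def corners_def image_iff)

lemma corners_iff:
  "t \<in> corners (a, b) \<longleftrightarrow> t = (a, b) \<or> t = (a + 1, b) \<or> t = (a, b + 1) \<or> t = (a + 1, b + 1)"
  by (cases t) (auto simp: corners_def)

section \<open>Eve's win in a region with many closed vertices\<close>

definition natpair :: "nat \<times> nat \<Rightarrow> int \<times> int" where
  "natpair s = (int (fst s), int (snd s))"

definition region_closed :: "nat \<Rightarrow> vertex \<Rightarrow> vertex set \<Rightarrow> bool" where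
  "region_closed k c K \<longleftrightarrow> crossing_closed k {s. odd_at c (natpair s) \<in> K}"

text \<open>The game from the moment when the token enters the region at \<open>y\<close>: it either starts there, when
\<open>x = y\<close>, or comes from an even vertex \<open>x\<close>. In the latter case the matching must not use the
visited vertex \<open>x\<close>, which is therefore required to lie outside of the rows of cells. The time bound is twice a bound on the number of cells.\<close>

lemma eve_wins_in_region:
  assumes K: "\<And>z. z \<in> K \<Longrightarrow> odd_vertex z" and c: "odd_vertex c"
    and good: "region_closed k c K"
    and y: "y = odd_at c (natpair s)" "s \<in> {..2*k} \<times> {..<2*k}" "y \<notin> K"
    and x: "\<And>a b. x = even_at c (a, b) \<Longrightarrow> a < 0 \<or> 2 * int k \<le> a"
  shows "eve_wins_within K (8 * k\<^sup>2) (y, {x, y})"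
proof -
  define C where "C = {s. odd_at c (natpair s) \<in> K}"
  define I where "I = {..2*k} \<times> {..<2*k} - C"
  define cells where "cells s = {(a, b). a < 2*k \<and> Suc b < 2*k \<and>
    (s = (a, b) \<or> s = (Suc a, b) \<or> s = (a, Suc b) \<or> s = (Suc a, Suc b))}" for s :: "nat \<times> nat"
  have fin: "finite (cells s)" for s
    by (rule finite_subset[of _ "{..<2*k} \<times> {..<2*k}"]) (auto simp: cells_def)
  have "\<exists>f. inj_on f I \<and> (\<forall>i\<in>I. f i \<in> cells i)"
  proof (rule hall_marriage)
    show "finite I" by (simp add: I_def)
    show "finite (cells i)" for i by (rule fin)
    fix J assume J: "J \<subseteq> I"
    have "card J \<le> card {(a, b). a < 2*k \<and> Suc b < 2*k \<and>
            ((a, b) \<in> J \<or> (Suc a, b) \<in> J \<or> (a, Suc b) \<in> J \<or> (Suc a, Suc b) \<in> J)}"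
      using J good by (intro region_hall[of k C]) (auto simp: I_def region_closed_def C_def)
    also have "\<dots> = card (\<Union>(cells ` J))"
      by (rule arg_cong[of _ _ card]) (auto simp: cells_def)
    finally show "card J \<le> card (\<Union>(cells ` J))" .
  qed
  then obtain f where f: "inj_on f I" "\<And>i. i \<in> I \<Longrightarrow> f i \<in> cells i" by blast
  have inj: "inj (odd_at c \<circ> natpair)" "inj (even_at c \<circ> natpair)"
    by (intro inj_compose inj_odd_at inj_even_at; auto simp: inj_def natpair_def prod_eq_iff)+
  define E where "E = even_at c ` natpair ` ({..<2*k} \<times> {..<2*k-1})"
  define D where "D = odd_at c ` natpair ` ({..2*k} \<times> {..<2*k})"
  define M where "M z = even_at c (natpair (f (inv (odd_at c \<circ> natpair) z)))" for z
  have inv: "inv (odd_at c \<circ> natpair) (odd_at c (natpair s)) = s" for s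
    using inv_f_f[OF inj(1), of s] by simp
  have DK: "\<exists>s. s \<in> I \<and> z = odd_at c (natpair s)" if "z \<in> D - K" for z
    using that unfolding D_def I_def C_def by blast
  have "eve_wins_within K (2 * card (E - {x, y})) (y, {x, y})"
  proof (rule eve_wins_by_matching[where M = M and D = D])
    show "finite E" by (simp add: E_def)
    show "M z \<in> E \<and> adjacent z (M z)" if "z \<in> D - K" for z
    proof -
      from DK[OF that] obtain s where s: "s \<in> I" "z = odd_at c (natpair s)" by blast
      obtain a b where ab: "f s = (a, b)" by (cases "f s")
      have *: "(a, b) \<in> cells s" using f(2)[OF s(1)] ab by simp
      have Mz: "M z = even_at c (natpair (a, b))" by (simp add: M_def s inv ab)
      have "natpair s \<in> corners (natpair (a, b))"
        using * by (auto simp: cells_def natpair_def corners_iff)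
      then have "adjacent (even_at c (natpair (a, b))) z"
        unfolding adjacent_even_at s(2) by (rule imageI)
      then have "adjacent z (M z)" using Mz adjacent_sym by simp
      then show ?thesis
        using * by (auto simp: Mz E_def cells_def)
    qed
    show "inj_on M (D - K)"
    proof (rule inj_onI)
      fix z z' assume z: "z \<in> D - K" "z' \<in> D - K" "M z = M z'"
      from DK[OF z(1)] obtain s where s: "s \<in> I" "z = odd_at c (natpair s)" by blast
      from DK[OF z(2)] obtain s' where s': "s' \<in> I" "z' = odd_at c (natpair s')" by blast
      have "f s = f s'"
        using z(3) injD[OF inj(2), of "f s" "f s'"] by (simp add: M_def s s' inv)
      then show "z = z'" using f(1) s s' by (auto dest: inj_onD)
    qed
    show "y' \<in> D" if "x' \<in> E" "adjacent x' y'" for x' y'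
    proof -
      from that(1) obtain a b where ab: "a < 2*k" "b < 2*k - 1" "x' = even_at c (int a, int b)"
        by (auto simp: E_def natpair_def)
      from that(2) have "y' \<in> odd_at c ` corners (int a, int b)" by (simp add: ab adjacent_even_at)
      then obtain t where t: "y' = odd_at c t" "t \<in> corners (int a, int b)" by blast
      then have "t \<in> natpair ` {(a, b), (Suc a, b), (a, Suc b), (Suc a, Suc b)}"
        by (auto simp: corners_iff natpair_def)
      moreover have "{(a, b), (Suc a, b), (a, Suc b), (Suc a, Suc b)} \<subseteq> {..2*k} \<times> {..<2*k}"
        using ab by auto
      ultimately show ?thesis unfolding D_def t(1) by blast
    qed
    show even: "\<not> odd_vertex z" if "z \<in> E" for z using that c by (auto simp: E_def even_at_even)
    show odd: "odd_vertex z" if "z \<in> D" for z using that c by (auto simp: D_def odd_at_odd)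
    show "odd_vertex z" if "z \<in> K" for z using K that by auto
    show "y \<in> D - K" using y by (auto simp: D_def)
    show "y \<in> {x, y}" by simp
    have xE: "x \<notin> E"
    proof
      assume "x \<in> E"
      then obtain a b where "a < 2*k" "x = even_at c (int a, int b)"
        by (auto simp: E_def natpair_def)
      then show False using x[of "int a" "int b"] by auto
    qed
    show "z \<in> {x, y} - {y}" if z: "z \<in> D - K" "M z \<in> {x, y}" for z
    proof -
      from DK[OF z(1)] obtain s where s: "s \<in> I" "z = odd_at c (natpair s)" by blast
      obtain a b where ab: "f s = (a, b)" by (cases "f s")
      have "(a, b) \<in> cells s" using f(2)[OF s(1)] ab by simp
      then have "M z \<in> E" by (auto simp: M_def s inv ab E_def cells_def)
      moreover have "\<not> odd_vertex (M z)" using c by (simp add: M_def even_at_even)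
      moreover have "odd_vertex y" using y c by (simp add: odd_at_odd)
      ultimately show ?thesis using xE z(2) by auto
    qed
  qed
  moreover have "card (E - {x, y}) \<le> 4 * k\<^sup>2"
  proof -
    have "card (E - {x, y}) \<le> card E" by (rule card_mono) (auto simp: E_def)
    also have "\<dots> \<le> card ({..<2*k} \<times> {..<2*k-1})"
      unfolding E_def by (intro order.trans[OF card_image_le] card_image_le) auto
    also have "\<dots> \<le> (2*k) * (2*k)" by (simp add: card_cartesian_product)
    finally show ?thesis by (simp add: power2_eq_square)
  qed
  ultimately show ?thesis by (auto elim!: eve_wins_within_mono)
qed

text \<open>The positions of Eve's regions. For odd \<open>v\<close> a single region with corner \<open>v\<close> suffices. An even \<open>v\<close> is
visited from the start and so must not lie in the region that the token enters; hence two regions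
are used, one starting with the row of odd vertices that follows \<open>v\<close> and one ending with the row
that precedes it. Each of them contains two of the four neighbours of \<open>v\<close>.\<close>

definition base_after :: "vertex \<Rightarrow> vertex" where
  "base_after v = (if odd_vertex v then v else (fst v, snd v + 1))"

definition base_before :: "nat \<Rightarrow> vertex \<Rightarrow> vertex" where
  "base_before k v = (if odd_vertex v then v else (fst v - 1 - 2 * int k, snd v - 2 * int k))"

lemma bases_odd: "odd_vertex (base_after v)" "odd_vertex (base_before k v)"
  by (auto simp: base_after_def base_before_def odd_vertex_def)

text \<open>If \<open>v\<close> is even, Odin's first move decides in which of the two regions the matching is played.\<close>

lemma eve_time_le_if_regions_closed:
  assumes K: "\<And>z. z \<in> K \<Longrightarrow> odd_vertex z" and k: "1 \<le> k"
    and good: "region_closed k (base_after v) K" "region_closed k (base_before k v) K"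
  shows "eve_time K v \<le> enat (Suc (8 * k\<^sup>2))"
proof (cases "v \<in> K")
  case True
  then show ?thesis using eve_time_closed K by simp
next
  case False
  have "eve_wins_within K (Suc (8 * k\<^sup>2)) (v, {v})"
  proof (cases "odd_vertex v")
    case True
    have "eve_wins_within K (8 * k\<^sup>2) (v, {v, v})"
    proof (rule eve_wins_in_region[where c = v and s = "(0, 0)"])
      show "region_closed k v K" using good True by (simp add: base_after_def)
      show "v = odd_at v (natpair (0, 0))" by (simp add: odd_at_def natpair_def)
      show "a < 0 \<or> 2 * int k \<le> a" if "v = even_at v (a, b)" for a b
        using that even_at_even[OF True] True by metis
    qed (use K True k False in auto)
    then have "eve_wins_within K (8 * k\<^sup>2) (v, {v})" by simp
    then show ?thesis by (rule eve_wins_within_mono) simp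
  next
    case v: False
    have "eve_wins_within K (8 * k\<^sup>2) (y, {y, v})" if y: "adjacent v y" "y \<notin> K" for y
    proof -
      consider "y = (fst v, snd v + 1)" | "y = (fst v + 1, snd v)"
        | "y = (fst v - 1, snd v)" | "y = (fst v, snd v - 1)"
        using y(1) by (auto simp: adjacent_iff)
      then have "(\<exists>s\<in>{..2*k} \<times> {..<2*k}. y = odd_at (base_after v) (natpair s)) \<or>
                 (\<exists>s\<in>{..2*k} \<times> {..<2*k}. y = odd_at (base_before k v) (natpair s))"
      proof cases
        case 1
        then show ?thesis using k v
          by (intro disjI1 bexI[of _ "(0, 0)"]) (auto simp: odd_at_def natpair_def base_after_def)
      next
        case 2
        then show ?thesis using k v
          by (intro disjI1 bexI[of _ "(0, 1)"]) (auto simp: odd_at_def natpair_def base_after_def)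
      next
        case 3
        then show ?thesis using k v
          by (intro disjI2 bexI[of _ "(2*k, 0)"]) (auto simp: odd_at_def natpair_def base_before_def)
      next
        case 4
        then show ?thesis using k v
          by (intro disjI2 bexI[of _ "(2*k, 1)"]) (auto simp: odd_at_def natpair_def base_before_def)
      qed
      then have "eve_wins_within K (8 * k\<^sup>2) (y, {v, y})"
      proof (elim disjE bexE)
        fix s assume s: "s \<in> {..2*k} \<times> {..<2*k}" "y = odd_at (base_after v) (natpair s)"
        show ?thesis
        proof (rule eve_wins_in_region[OF K bases_odd(1) good(1) s(2,1) y(2)])
          show "a < 0 \<or> 2 * int k \<le> a" if "v = even_at (base_after v) (a, b)" for a b
            using that v by (cases v) (auto simp: even_at_def base_after_def)
        qed
      next
        fix s assume s: "s \<in> {..2*k} \<times> {..<2*k}" "y = odd_at (base_before k v) (natpair s)"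
        show ?thesis
        proof (rule eve_wins_in_region[OF K bases_odd(2) good(2) s(2,1) y(2)])
          show "a < 0 \<or> 2 * int k \<le> a" if "v = even_at (base_before k v) (a, b)" for a b
            using that v by (cases v) (auto simp: even_at_def base_before_def)
        qed
      qed
      then show ?thesis by (simp add: insert_commute)
    qed
    then show ?thesis using v by (auto simp: to_move_def legal_moves_def move_to_def)
  qed
  then show ?thesis using eve_time_le_iff[OF False] by blast
qed

section \<open>Odin's survival among sparse closed vertices\<close>

text \<open>A square of cells large enough to contain every even vertex within distance \<open>n\<close> of the centre.\<close>

definition even_grid :: "nat \<Rightarrow> (int \<times> int) set" where
  "even_grid n = {-(int n + 1)..int n + 1} \<times> {-(int n + 1)..int n + 1}"

definition square :: "int \<Rightarrow> int \<Rightarrow> nat \<Rightarrow> (int \<times> int) set" where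
  "square i j m = {i..<i + int m} \<times> {j..<j + int m}"

definition closed_sparse :: "nat \<Rightarrow> vertex \<Rightarrow> vertex set \<Rightarrow> bool" where
  "closed_sparse n c K \<longleftrightarrow>
     (\<forall>m i j. 2 \<le> m \<longrightarrow> m \<le> 2 * n + 4 \<longrightarrow> square i j m \<inter> even_grid n \<noteq> {} \<longrightarrow>
        card ({s. odd_at c s \<in> K} \<inter> square i j m) \<le> m)"

definition centre_base :: "vertex \<Rightarrow> vertex" where
  "centre_base v = (if odd_vertex v then v else (fst v - 1, snd v))"

lemma centre_base_odd: "odd_vertex (centre_base v)"
  by (auto simp: centre_base_def odd_vertex_def)

lemma even_grid_covers:
  assumes "\<not> odd_vertex z" "l1_dist z v \<le> int n"
  obtains s where "s \<in> even_grid n" "z = even_at (centre_base v) s"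
proof -
  obtain s where s: "z = even_at (centre_base v) s"
    using even_at_coordinates[OF centre_base_odd assms(1)] .
  have "\<bar>fst (even_at (centre_base v) s) - fst v\<bar> + \<bar>snd (even_at (centre_base v) s) - snd v\<bar> \<le> int n"
    using assms(2) by (simp add: s l1_dist_def)
  then have "fst s \<in> {-(int n + 1)..int n + 1} \<and> snd s \<in> {-(int n + 1)..int n + 1}"
    by (simp add: even_at_def centre_base_def split: if_splits) linarith+
  then have "s \<in> even_grid n" by (cases s) (simp add: even_grid_def)
  then show thesis using s that by blast
qed

text \<open>If \<open>v\<close> is odd it is visited from the start and is as good as closed. This raises the number of
forbidden corners in a square of side \<open>m\<close> from \<open>m\<close> to \<open>m + 1\<close>, which the expansion still allows.\<close>

lemma sparse_matching:
  assumes sparse: "closed_sparse n c K"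
  shows "\<exists>f. inj_on f (even_grid n) \<and>
    (\<forall>s\<in>even_grid n. f s \<in> corners s - {s. odd_at c s \<in> insert v K})"
proof -
  let ?C = "{s. odd_at c s \<in> insert v K}"
  show ?thesis
  proof (rule hall_marriage)
    show "finite (even_grid n)" by (simp add: even_grid_def)
    show "finite (corners s - ?C)" for s by (simp add: corners_def)
    fix J assume J: "J \<subseteq> even_grid n"
    have "card J \<le> card (\<Union>(corners ` J) - ?C)"
    proof (rule corners_hall[where M = "2 * n + 4" and G = "even_grid n"])
      fix m i j
      assume m: "2 \<le> m" "m \<le> 2 * n + 4" "{i..<i + int m} \<times> {j..<j + int m} \<inter> even_grid n \<noteq> {}"
      have "card {s. odd_at c s = v} \<le> 1"
        using inj_odd_at[of c] by (intro card_le_Suc0_iff_eq[THEN iffD2, simplified One_nat_def[symmetric]])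
          (auto simp: inj_def intro: finite_vimageI[of "{v}" "odd_at c", unfolded vimage_def, simplified])
      have "?C \<inter> square i j m \<subseteq> {s. odd_at c s = v} \<union> ({s. odd_at c s \<in> K} \<inter> square i j m)" by auto
      then have "card (?C \<inter> square i j m) \<le> card ({s. odd_at c s = v} \<union> ({s. odd_at c s \<in> K} \<inter> square i j m))"
        using finite_vimageI[OF _ inj_odd_at, of "{v}" c]
        by (intro card_mono) (auto simp: vimage_def square_def)
      also have "\<dots> \<le> 1 + m"
        using m sparse \<open>card {s. odd_at c s = v} \<le> 1\<close>
        by (intro order.trans[OF card_Un_le] add_mono) (auto simp: closed_sparse_def square_def)
      finally show "card (?C \<inter> {i..<i + int m} \<times> {j..<j + int m}) \<le> Suc m" by (simp add: square_def)
    next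
      show "finite J" using J by (rule finite_subset) (simp add: even_grid_def)
      fix A assume "A = fst ` J \<or> A = snd ` J"
      then have "A \<subseteq> {-(int n + 1)..int n + 1}" using J by (auto simp: even_grid_def)
      then have "card A \<le> card {-(int n + 1)..int n + 1}" by (intro card_mono) auto
      then show "card A < 2 * n + 4" by simp
    qed (use J in auto)
    also have "\<Union>(corners ` J) - ?C = (\<Union>s\<in>J. corners s - ?C)" by auto
    finally show "card J \<le> card (\<Union>s\<in>J. corners s - ?C)" .
  qed
qed

lemma eve_time_gt_if_sparse:
  assumes sparse: "closed_sparse n (centre_base v) K" and v: "v \<notin> K"
  shows "\<not> eve_time K v \<le> enat n"
proof -
  let ?c = "centre_base v"
  obtain f where f: "inj_on f (even_grid n)"
    "\<And>s. s \<in> even_grid n \<Longrightarrow> f s \<in> corners s - {s. odd_at ?c s \<in> insert v K}"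
    using sparse_matching[OF sparse, of v] by blast
  define F where "F z = odd_at ?c (f (inv (even_at ?c) z))" for z
  have F: "F (even_at ?c s) = odd_at ?c (f s)" for s
    by (simp add: F_def inv_f_f[OF inj_even_at])
  have FK: "adjacent z (F z) \<and> F z \<notin> insert v K" if z: "\<not> odd_vertex z" "l1_dist z v \<le> int n" for z
  proof -
    obtain s where s: "s \<in> even_grid n" "z = even_at ?c s" using even_grid_covers[OF z] .
    then show ?thesis using f(2)[OF s(1)] by (auto simp: F adjacent_even_at)
  qed
  have injF: "inj_on F {z. \<not> odd_vertex z \<and> l1_dist z v \<le> int n}"
  proof (rule inj_onI)
    fix z z' assume z: "z \<in> {z. \<not> odd_vertex z \<and> l1_dist z v \<le> int n}"
      "z' \<in> {z. \<not> odd_vertex z \<and> l1_dist z v \<le> int n}" "F z = F z'"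
    obtain s where s: "s \<in> even_grid n" "z = even_at ?c s" using even_grid_covers[of z v n] z by auto
    obtain s' where s': "s' \<in> even_grid n" "z' = even_at ?c s'" using even_grid_covers[of z' v n] z by auto
    have "f s = f s'" using z(3) injD[OF inj_odd_at] by (auto simp: F s s')
    then show "z = z'" using f(1) s s' by (auto dest: inj_onD)
  qed
  have odin: "\<not> eve_wins_within K t (x, insert x {v})"
    if x: "\<not> odd_vertex x" "l1_dist x v + int t \<le> int n" for x t
  proof (rule odin_survives_by_matching[OF _ injF x])
    show "adjacent z (F z) \<and> F z \<notin> K" if "\<not> odd_vertex z" "l1_dist z v \<le> int n" for z
      using FK[OF that] by simp
    show "x \<in> insert x {v}" by simp
    fix z assume z: "\<not> odd_vertex z" "l1_dist z v \<le> int n" "F z \<in> insert x {v}"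
    have "F z = x" "adjacent z (F z)" using FK[OF z(1,2)] z(3) by auto
    then have False using adjacent_odd z(1) x(1) by blast
    then show "z \<in> insert x {v} - {x}" ..
  qed
  have "\<not> eve_wins_within K n (v, {v})"
  proof (cases "odd_vertex v")
    case False
    then show ?thesis using odin[of v n] by (simp add: l1_dist_def)
  next
    case True
    show ?thesis
    proof (cases n)
      case 0
      then show ?thesis using True by (simp add: to_move_def)
    next
      case (Suc t)
      have "\<not> eve_wins_within K t (y, insert y {v})" if "adjacent v y" for y
      proof (rule odin)
        show "\<not> odd_vertex y" using that True adjacent_odd by blast
        show "l1_dist y v + int t \<le> int n" using that Suc by (simp add: adjacent_def l1_dist_def)
      qed
      then show ?thesis using True Suc by (auto simp: to_move_def legal_moves_def move_to_def)
    qed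
  qed
  then show ?thesis using eve_time_le_iff[OF v] by blast
qed

section \<open>Measurability\<close>

lemma percolation_product:
  "product_prob_space (\<lambda>_ :: vertex. measure_pmf (bernoulli_pmf p))"
  by (intro product_prob_spaceI) (simp add: prob_space_measure_pmf)

lemma prob_space_percolation: "prob_space (percolation p)"
  unfolding percolation_def by (intro prob_space_PiM prob_space_measure_pmf)

lemma measure_percolation_block:
  assumes "0 \<le> p" "p \<le> 1" "finite A" "A \<subseteq> Collect odd_vertex"
  shows "measure (percolation p) {\<omega> \<in> space (percolation p). \<forall>x\<in>A. \<omega> x = b} =
           (if b then p else 1 - p) ^ card A"
proof -
  interpret product_prob_space "\<lambda>_ :: vertex. measure_pmf (bernoulli_pmf p)" "Collect odd_vertex"
    by (rule percolation_product)
  have "emeasure (percolation p) {\<omega> \<in> space (percolation p). \<forall>x\<in>A. \<omega> x \<in> {b}} =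
      (\<Prod>x\<in>A. emeasure (measure_pmf (bernoulli_pmf p)) {b})"
    unfolding percolation_def using assms by (intro emeasure_PiM_Collect) auto
  also have "\<dots> = ennreal ((if b then p else 1 - p) ^ card A)"
    using assms by (cases b) (simp_all add: emeasure_pmf_single ennreal_power)
  finally show ?thesis using assms by (simp add: measure_def)
qed

lemma pred_site [measurable]:
  "Measurable.pred (percolation p) (\<lambda>\<omega>. x \<in> closed_set \<omega>)"
proof (cases "odd_vertex x")
  case True
  then have "(\<lambda>\<omega>. \<omega> x) \<in> percolation p \<rightarrow>\<^sub>M measure_pmf (bernoulli_pmf p)"
    unfolding percolation_def by (intro measurable_component_singleton) simp
  then have "(\<lambda>\<omega>. \<omega> x) \<in> percolation p \<rightarrow>\<^sub>M count_space UNIV" by simp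
  then show ?thesis using True by (simp add: closed_set_def)
next
  case False
  then show ?thesis by (simp add: closed_set_def)
qed

lemma finite_neighbours: "finite {y. adjacent u y}"
  by (simp add: adjacent_iff)

lemma pred_eve_wins_within [measurable]:
  "Measurable.pred (percolation p) (\<lambda>\<omega>. eve_wins_within (closed_set \<omega>) t q)"
proof (induction t arbitrary: q)
  case 0
  define N where "N q = {y. adjacent (fst q) y}" for q :: position
  have finN: "finite (N q)" for q unfolding N_def by (rule finite_neighbours)
  have "eve_wins_within (closed_set \<omega>) 0 q \<longleftrightarrow>
      to_move q = Odin \<and> (\<forall>y\<in>N q. y \<in> snd q \<or> y \<in> closed_set \<omega>)" for \<omega>
    by (auto simp: legal_moves_def N_def)
  then show ?case using finN by simp
next
  case (Suc t)
  note Suc [measurable]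
  define N where "N q = {y. adjacent (fst q) y}" for q :: position
  have finN: "finite (N q)" for q unfolding N_def by (rule finite_neighbours)
  have *: "eve_wins_within (closed_set \<omega>) (Suc t) q \<longleftrightarrow>
      (if to_move q = Odin
       then \<forall>y\<in>N q. y \<in> snd q \<or> y \<in> closed_set \<omega> \<or> eve_wins_within (closed_set \<omega>) t (move_to q y)
       else \<exists>y\<in>N q. y \<notin> snd q \<and> y \<notin> closed_set \<omega> \<and> eve_wins_within (closed_set \<omega>) t (move_to q y))" for \<omega>
    by (cases "to_move q") (auto simp: legal_moves_def N_def)
  show ?case unfolding * using finN by (cases "to_move q = Odin") simp_all
qed

lemma closed_set_odd: "z \<in> closed_set \<omega> \<Longrightarrow> odd_vertex z"
  by (simp add: closed_set_def)

lemma pred_eve_time_le [measurable]: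
  "Measurable.pred (percolation p) (\<lambda>\<omega>. eve_time (closed_set \<omega>) v \<le> enat t)"
proof -
  have "eve_time (closed_set \<omega>) v \<le> enat t \<longleftrightarrow>
      v \<in> closed_set \<omega> \<or> eve_wins_within (closed_set \<omega>) t (v, {v})" if "v \<notin> closed_set \<omega>" for \<omega>
    using that eve_time_le_iff by auto
  moreover have "eve_time (closed_set \<omega>) v \<le> enat t" if "v \<in> closed_set \<omega>" for \<omega>
    using that eve_time_closed closed_set_odd by (metis zero_le)
  ultimately have "eve_time (closed_set \<omega>) v \<le> enat t \<longleftrightarrow>
      v \<in> closed_set \<omega> \<or> eve_wins_within (closed_set \<omega>) t (v, {v})" for \<omega>
    by blast
  then show ?thesis by simp
qed

lemma ereal_of_enat_le_iff:
  "ereal_of_enat T \<le> ereal b \<longleftrightarrow> (\<exists>t. real t \<le> b \<and> T \<le> enat t)"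
  by (cases T) (auto intro: order.trans[rotated])

lemma le_ereal_of_enat_iff:
  "ereal a \<le> ereal_of_enat T \<longleftrightarrow> (\<forall>t. real t < a \<longrightarrow> \<not> T \<le> enat t)"
proof (cases T)
  case (enat n)
  have "a \<le> real n \<longleftrightarrow> (\<forall>t. real t < a \<longrightarrow> \<not> n \<le> t)"
  proof
    assume *: "\<forall>t. real t < a \<longrightarrow> \<not> n \<le> t"
    show "a \<le> real n" using *[rule_format, of n] by force
  qed auto
  then show ?thesis using enat by simp
qed simp

text \<open>The event of the theorem is described by countably many events \<open>eve_time (closed_set \<omega>) v \<le> enat t\<close>,
each of which is settled by the sites that can be reached in \<open>t\<close> moves.\<close>

lemma time_window_event:
  "{\<omega> \<in> space (percolation p). ereal a \<le> ereal_of_enat (eve_time (closed_set \<omega>) v) \<and>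
      ereal_of_enat (eve_time (closed_set \<omega>) v) \<le> ereal b} \<in> sets (percolation p)"
  unfolding ereal_of_enat_le_iff le_ereal_of_enat_iff by measurable

lemma pred_region_closed [measurable]:
  "Measurable.pred (percolation p) (\<lambda>\<omega>. region_closed k c (closed_set \<omega>))"
proof -
  have "region_closed k c (closed_set \<omega>) \<longleftrightarrow>
      (\<forall>A\<in>crossing_blocks k. \<exists>s\<in>A. odd_at c (natpair s) \<in> closed_set \<omega>)" for \<omega>
    by (auto simp: region_closed_def crossing_closed_iff_blocks)
  moreover have "Measurable.pred (percolation p)
      (\<lambda>\<omega>. \<forall>A\<in>crossing_blocks k. \<exists>s\<in>A. odd_at c (natpair s) \<in> closed_set \<omega>)"
    by (intro pred_intros_finite card_crossing_blocks crossing_blocks_block pred_site)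
  ultimately show ?thesis by simp
qed

text \<open>In this form, sparseness is visibly measurable and its failure is a union of events saying that
all vertices of a given set are closed.\<close>

lemma closed_sparse_iff_subsets:
  "closed_sparse n c K \<longleftrightarrow>
     (\<forall>m i j. 2 \<le> m \<longrightarrow> m \<le> 2 * n + 4 \<longrightarrow> square i j m \<inter> even_grid n \<noteq> {} \<longrightarrow>
        (\<forall>A\<in>{A. A \<subseteq> square i j m \<and> card A = Suc m}. \<exists>s\<in>A. odd_at c s \<notin> K))"
proof -
  have "card ({s. odd_at c s \<in> K} \<inter> square i j m) \<le> m \<longleftrightarrow>
      (\<forall>A\<in>{A. A \<subseteq> square i j m \<and> card A = Suc m}. \<exists>s\<in>A. odd_at c s \<notin> K)" for m i j
  proof
    assume *: "card ({s. odd_at c s \<in> K} \<inter> square i j m) \<le> m"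
    show "\<forall>A\<in>{A. A \<subseteq> square i j m \<and> card A = Suc m}. \<exists>s\<in>A. odd_at c s \<notin> K"
    proof (rule ballI, rule ccontr)
      fix A assume A: "A \<in> {A. A \<subseteq> square i j m \<and> card A = Suc m}" "\<not> (\<exists>s\<in>A. odd_at c s \<notin> K)"
      then have "card A \<le> card ({s. odd_at c s \<in> K} \<inter> square i j m)"
        by (intro card_mono) (auto simp: square_def)
      then show False using * A by simp
    qed
  next
    assume *: "\<forall>A\<in>{A. A \<subseteq> square i j m \<and> card A = Suc m}. \<exists>s\<in>A. odd_at c s \<notin> K"
    show "card ({s. odd_at c s \<in> K} \<inter> square i j m) \<le> m"
    proof (rule ccontr)
      assume "\<not> card ({s. odd_at c s \<in> K} \<inter> square i j m) \<le> m"
      then have "Suc m \<le> card ({s. odd_at c s \<in> K} \<inter> square i j m)" by simp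
      then obtain A where "A \<subseteq> {s. odd_at c s \<in> K} \<inter> square i j m" "card A = Suc m"
        by (meson obtain_subset_with_card_n)
      then show False using * by blast
    qed
  qed
  then show ?thesis by (simp add: closed_sparse_def)
qed

lemma finite_subsets_of_square: "finite {A. A \<subseteq> square i j m \<and> card A = Suc m}"
  by (rule finite_subset[of _ "Pow (square i j m)"]) (auto simp: square_def)

lemma pred_closed_sparse [measurable]:
  "Measurable.pred (percolation p) (\<lambda>\<omega>. closed_sparse n c (closed_set \<omega>))"
proof -
  have "Measurable.pred (percolation p)
      (\<lambda>\<omega>. \<forall>A\<in>{A. A \<subseteq> square i j m \<and> card A = Suc m}. \<exists>s\<in>A. odd_at c s \<notin> closed_set \<omega>)" for i j m
    by (intro pred_intros_finite pred_intros_logic finite_subsets_of_square pred_site)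
       (auto intro: card_ge_0_finite)
  note this [measurable]
  show ?thesis unfolding closed_sparse_iff_subsets by measurable
qed

section \<open>Union bounds\<close>

lemma prob_constant_block_le:
  assumes p: "0 \<le> p" "p \<le> 1" and fin: "finite \<A>"
    and A: "\<And>A. A \<in> \<A> \<Longrightarrow> finite A \<and> A \<subseteq> Collect odd_vertex \<and> card A = k"
    and X: "\<And>\<omega>. \<omega> \<in> X \<Longrightarrow> \<omega> \<in> space (percolation p) \<and> (\<exists>A\<in>\<A>. \<forall>x\<in>A. x \<in> closed_set \<omega> \<longleftrightarrow> b)"
  shows "measure (percolation p) X \<le> real (card \<A>) * (if b then p else 1 - p) ^ k"
proof -
  interpret prob_space "percolation p" by (rule prob_space_percolation)
  define S where "S A = {\<omega> \<in> space (percolation p). \<forall>x\<in>A. \<omega> x = b}" for A :: "vertex set"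
  have eq: "S A = {\<omega> \<in> space (percolation p). \<forall>x\<in>A. x \<in> closed_set \<omega> \<longleftrightarrow> b}" if "A \<in> \<A>" for A
    using A[OF that] by (auto simp: S_def closed_set_def)
  have meas: "S A \<in> sets (percolation p)" if "A \<in> \<A>" for A
    unfolding eq[OF that] using A[OF that] by simp
  have "X \<subseteq> (\<Union>A\<in>\<A>. S A)"
    using X by (fastforce simp: eq)
  then have "prob X \<le> prob (\<Union>A\<in>\<A>. S A)"
    using meas fin by (intro finite_measure_mono sets.finite_UN) auto
  also have "\<dots> \<le> (\<Sum>A\<in>\<A>. prob (S A))"
    using meas fin by (intro finite_measure_subadditive_finite) auto
  also have "\<dots> = (\<Sum>A\<in>\<A>. (if b then p else 1 - p) ^ k)"
    using A p measure_percolation_block by (intro sum.cong) (auto simp: S_def)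
  finally show ?thesis by simp
qed

text \<open>A union bound over the crossing blocks, each of which is entirely open with probability \<open>(1 - p) ^ k\<close>.\<close>

lemma prob_region_not_closed:
  assumes p: "0 \<le> p" "p \<le> 1" and c: "odd_vertex c"
  shows "measure (percolation p) {\<omega> \<in> space (percolation p). \<not> region_closed k c (closed_set \<omega>)}
     \<le> 4 * real k * (1 - p) ^ k"
proof -
  let ?g = "odd_at c \<circ> natpair"
  have inj: "inj ?g"
    by (intro inj_compose inj_odd_at) (auto simp: inj_def natpair_def prod_eq_iff)
  let ?A = "(`) ?g ` crossing_blocks k"
  have "measure (percolation p) {\<omega> \<in> space (percolation p). \<not> region_closed k c (closed_set \<omega>)}
      \<le> real (card ?A) * (if False then p else 1 - p) ^ k"
  proof (rule prob_constant_block_le[OF p])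
    show "finite ?A" by (simp add: card_crossing_blocks)
    show "finite B \<and> B \<subseteq> Collect odd_vertex \<and> card B = k" if "B \<in> ?A" for B
    proof -
      from that obtain A where A: "A \<in> crossing_blocks k" "B = ?g ` A" by blast
      have "card B = card A" unfolding A(2) by (intro card_image inj_on_subset[OF inj]) auto
      then show ?thesis using crossing_blocks_block[OF A(1)] c by (auto simp: A(2) odd_at_odd)
    qed
    fix \<omega> assume w: "\<omega> \<in> {\<omega> \<in> space (percolation p). \<not> region_closed k c (closed_set \<omega>)}"
    then obtain A where "A \<in> crossing_blocks k" "A \<inter> {s. odd_at c (natpair s) \<in> closed_set \<omega>} = {}"
      by (auto simp: region_closed_def crossing_closed_iff_blocks)
    then show "\<omega> \<in> space (percolation p) \<and> (\<exists>B\<in>?A. \<forall>x\<in>B. (x \<in> closed_set \<omega>) = False)"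
      using w by auto
  qed
  also have "\<dots> \<le> 4 * real k * (1 - p) ^ k"
  proof -
    have "card ?A \<le> 4 * k"
      using card_image_le[OF card_crossing_blocks(1)] card_crossing_blocks(2) order.trans by blast
    then have "real (card ?A) \<le> 4 * real k" by linarith
    then show ?thesis using p by (auto intro!: mult_right_mono)
  qed
  finally show ?thesis .
qed

text \<open>A crude form of Stirling's bound, obtained from one term of the exponential series.\<close>

lemma power_le_fact_three: "real n ^ n \<le> 3 ^ n * fact n"
proof -
  have "real n ^ n / fact n \<le> exp (real n)"
  proof -
    have "(\<Sum>i\<in>{n}. real n ^ i /\<^sub>R fact i) \<le> exp (real n)"
      unfolding exp_def by (rule sum_le_suminf[OF summable_exp_generic]) auto
    then show ?thesis by (simp add: divide_inverse_commute)
  qed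
  also have "\<dots> = exp 1 ^ n" by (simp add: exp_of_nat_mult[symmetric])
  also have "\<dots> \<le> 3 ^ n" using exp_le by (intro power_mono) auto
  finally show ?thesis by (simp add: field_simps)
qed

lemma binomial_square_le: "real ((m * m) choose Suc m) \<le> (3 * real m) ^ Suc m"
proof -
  have "real ((m * m) choose Suc m) * fact (Suc m) \<le> real (m * m) ^ Suc m"
    using binomial_fact_pow[of "m * m" "Suc m"] by (metis of_nat_fact of_nat_le_iff of_nat_mult of_nat_power)
  also have "\<dots> = real m ^ Suc m * real m ^ Suc m" by (simp add: power_mult_distrib)
  also have "\<dots> \<le> real m ^ Suc m * real (Suc m) ^ Suc m"
    by (intro mult_left_mono power_mono) auto
  also have "\<dots> \<le> real m ^ Suc m * (3 ^ Suc m * fact (Suc m))"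
    by (intro mult_left_mono power_le_fact_three) auto
  also have "\<dots> = (3 * real m) ^ Suc m * fact (Suc m)"
    by (simp add: power_mult_distrib)
  finally show ?thesis by (simp only: mult_le_cancel_right fact_gt_zero)
qed

lemma cube_le_power: "real m ^ 3 \<le> 8 ^ m"
proof -
  have "real m \<le> 2 ^ m" by (simp add: less_imp_le of_nat_less_two_power)
  then have "real m ^ 3 \<le> (2 ^ m) ^ 3" by (intro power_mono) auto
  also have "\<dots> = (8::real) ^ m" by (simp add: power_mult[symmetric] mult.commute[of m] power_mult)
  finally show ?thesis .
qed

text \<open>With \<open>M = 2 * n + 4\<close>, there are at most \<open>4 * M\<^sup>2\<close> squares of side \<open>m\<close> that matter, and a given one of them
contains \<open>m + 1\<close> closed vertices with probability at most \<open>(3 * m * p) ^ (m + 1)\<close>. As \<open>m \<ge> 2\<close>, three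
of the \<open>m + 1\<close> factors can be split off; they supply \<open>p ^ 3\<close>, of which \<open>p\<^sup>2\<close> is spent on \<open>M\<^sup>2\<close>. The
other factors are at most \<open>1/16\<close>, which outweighs \<open>m ^ 3 \<le> 8 ^ m\<close> and makes the sum over \<open>m\<close>
a geometric series.\<close>

lemma prob_not_sparse:
  assumes p: "0 < p" "p \<le> 1" and c: "odd_vertex c" and n: "48 * (2 * real n + 4) * p \<le> 1"
  shows "measure (percolation p) {\<omega> \<in> space (percolation p). \<not> closed_sparse n c (closed_set \<omega>)}
     \<le> 12 * p"
proof -
  interpret prob_space "percolation p" by (rule prob_space_percolation)
  define M where "M = 2 * n + 4"
  \<comment> \<open>Lower left corners of squares of side at most \<open>M\<close> that can meet the grid of even vertices.\<close>
  define Q where "Q = {- (int n + 1) - int M..<- (int n + 1) - int M + 2 * int M}"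
  define \<A> where "\<A> m = (\<Union>(i, j)\<in>Q \<times> Q. (`) (odd_at c) ` {A. A \<subseteq> square i j m \<and> card A = Suc m})" for m
  define X where "X m = {\<omega> \<in> space (percolation p). \<exists>A\<in>\<A> m. \<forall>x\<in>A. x \<in> closed_set \<omega>}" for m
  have finsquare: "finite (square i j m)" "card (square i j m) = m * m" for i j m
    by (simp_all add: square_def card_cartesian_product)
  have fin: "finite (\<A> m)" for m
    unfolding \<A>_def Q_def using finite_subsets_of_square by auto
  have card: "card (\<A> m) \<le> (2 * M) * (2 * M) * ((m * m) choose Suc m)" for m
  proof -
    have "card (\<A> m) \<le> (\<Sum>(i, j)\<in>Q \<times> Q. card ((`) (odd_at c) ` {A. A \<subseteq> square i j m \<and> card A = Suc m}))"
      unfolding \<A>_def by (rule order.trans[OF card_UN_le]) (auto simp: Q_def case_prod_beta)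
    also have "\<dots> \<le> (\<Sum>(i, j)\<in>Q \<times> Q. ((m * m) choose Suc m))"
    proof (intro sum_mono, clarify)
      fix i j
      have "card ((`) (odd_at c) ` {A. A \<subseteq> square i j m \<and> card A = Suc m}) \<le> card {A. A \<subseteq> square i j m \<and> card A = Suc m}"
        by (rule card_image_le[OF finite_subsets_of_square])
      then show "card ((`) (odd_at c) ` {A. A \<subseteq> square i j m \<and> card A = Suc m}) \<le> ((m * m) choose Suc m)"
        using n_subsets[OF finsquare(1)] finsquare(2) by simp
    qed
    also have "\<dots> = card (Q \<times> Q) * ((m * m) choose Suc m)" by simp
    also have "card (Q \<times> Q) = (2 * M) * (2 * M)" by (simp add: Q_def card_cartesian_product nat_mult_distrib)
    finally show ?thesis .
  qed
  have block: "finite B \<and> B \<subseteq> Collect odd_vertex \<and> card B = Suc m" if B: "B \<in> \<A> m" for B m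
  proof -
    from B obtain i j A where A: "A \<subseteq> square i j m" "card A = Suc m" "B = odd_at c ` A"
      by (auto simp: \<A>_def)
    have "card B = card A" unfolding A(3) by (intro card_image inj_on_subset[OF inj_odd_at]) auto
    then show ?thesis using A c finite_subset[OF A(1) finsquare(1)] by (auto simp: odd_at_odd)
  qed
  have X_meas: "X m \<in> sets (percolation p)" for m
  proof -
    have "Measurable.pred (percolation p) (\<lambda>\<omega>. \<exists>A\<in>\<A> m. \<forall>x\<in>A. x \<in> closed_set \<omega>)"
      by (intro pred_intros_finite fin pred_site) (use block in blast)
    then show ?thesis unfolding X_def by measurable
  qed
  have pX: "prob (X m) \<le> 12 * p * (1/2) ^ m" if m: "2 \<le> m" "m \<le> M" for m
  proof -
    have "prob (X m) \<le> real (card (\<A> m)) * (if True then p else 1 - p) ^ Suc m"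
      using p by (intro prob_constant_block_le fin block) (auto simp: X_def)
    also have "\<dots> \<le> real ((2 * M) * (2 * M) * ((m * m) choose Suc m)) * p ^ Suc m"
      using card[of m] p by (auto intro!: mult_right_mono simp del: of_nat_mult)
    also have "\<dots> = 4 * (real M)\<^sup>2 * (real ((m * m) choose Suc m) * p ^ Suc m)"
      by (simp add: power2_eq_square)
    also have "\<dots> \<le> 4 * (real M)\<^sup>2 * ((3 * real m) ^ Suc m * p ^ Suc m)"
      using p by (intro mult_left_mono mult_right_mono binomial_square_le) auto
    also have "(3 * real m) ^ Suc m * p ^ Suc m = (3 * real m * p) ^ 3 * (3 * real m * p) ^ (m - 2)"
    proof -
      have "Suc m = 3 + (m - 2)" using m by simp
      then show ?thesis by (metis power_mult_distrib power_add)
    qed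
    also have "4 * (real M)\<^sup>2 * \<dots> \<le> 4 * (real M)\<^sup>2 * ((3 * real m * p) ^ 3 * (1/16) ^ (m - 2))"
    proof (intro mult_left_mono power_mono)
      have "real m * p \<le> real M * p" using m p by (intro mult_right_mono) auto
      also have "48 * (real M * p) \<le> 1" using n by (simp add: M_def algebra_simps)
      finally show "3 * real m * p \<le> 1/16" by simp
    qed (use p in auto)
    also have "(1/16 :: real) ^ (m - 2) = 256 * (1/16) ^ m"
    proof -
      have "m = m - 2 + 2" using m by simp
      then have "(1/16 :: real) ^ m = (1/16) ^ (m - 2) * (1/16)\<^sup>2" by (metis power_add)
      then show ?thesis by (simp only: power2_eq_square)
    qed
    also have "4 * (real M)\<^sup>2 * ((3 * real m * p) ^ 3 * (256 * (1/16) ^ m)) =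
        27648 * (real M * p)\<^sup>2 * p * (real m ^ 3 * (1/16) ^ m)"
      by (simp add: power_mult_distrib power2_eq_square power3_eq_cube)
    also have "\<dots> \<le> 27648 * (1/48)\<^sup>2 * p * (8 ^ m * (1/16) ^ m)"
    proof (intro mult_mono power_mono cube_le_power order.refl)
      show "real M * p \<le> 1/48" using n by (simp add: M_def algebra_simps)
    qed (use p in auto)
    also have "\<dots> = 12 * p * (1/2) ^ m"
    proof -
      have "(8::real) ^ m * (1/16) ^ m = (8 * (1/16)) ^ m" by (rule power_mult_distrib[symmetric])
      then show ?thesis by (simp add: power2_eq_square)
    qed
    finally show ?thesis .
  qed
  have sub: "{\<omega> \<in> space (percolation p). \<not> closed_sparse n c (closed_set \<omega>)} \<subseteq> (\<Union>m\<in>{2..M}. X m)"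
  proof
    fix \<omega> assume w: "\<omega> \<in> {\<omega> \<in> space (percolation p). \<not> closed_sparse n c (closed_set \<omega>)}"
    then have "\<not> closed_sparse n c (closed_set \<omega>)" by simp
    then obtain m i j A where m: "2 \<le> m" "m \<le> M" and ne: "square i j m \<inter> even_grid n \<noteq> {}"
      and A: "A \<subseteq> square i j m" "card A = Suc m" "\<forall>s\<in>A. odd_at c s \<in> closed_set \<omega>"
      unfolding closed_sparse_iff_subsets M_def by blast
    have "(i, j) \<in> Q \<times> Q"
      using ne m by (auto simp: Q_def square_def even_grid_def M_def)
    then have "odd_at c ` A \<in> \<A> m" using A unfolding \<A>_def by blast
    moreover have "\<forall>x\<in>odd_at c ` A. x \<in> closed_set \<omega>" using A by auto
    ultimately have "\<omega> \<in> X m" using w unfolding X_def by blast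
    then show "\<omega> \<in> (\<Union>m\<in>{2..M}. X m)" using m by auto
  qed
  have "prob {\<omega> \<in> space (percolation p). \<not> closed_sparse n c (closed_set \<omega>)} \<le> prob (\<Union>m\<in>{2..M}. X m)"
    using sub X_meas by (intro finite_measure_mono sets.finite_UN) auto
  also have "\<dots> \<le> (\<Sum>m\<in>{2..M}. prob (X m))"
    using X_meas by (intro finite_measure_subadditive_finite) auto
  also have "\<dots> \<le> (\<Sum>m\<in>{2..M}. 12 * p * (1/2) ^ m)" by (intro sum_mono pX) auto
  also have "\<dots> = 12 * p * (\<Sum>m\<in>{2..M}. (1/2) ^ m)" by (simp add: sum_distrib_left)
  also have "(\<Sum>m\<in>{2..M}. (1/2 :: real) ^ m) \<le> 1"
    by (subst sum_gp) (auto simp: M_def field_simps)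
  finally show ?thesis using p by simp
qed

section \<open>The winning time\<close>

theorem corollary16:
  "\<exists>c1 C1 :: real. c1 > 0 \<and> C1 > 0 \<and>
     (\<forall>v :: vertex.
       ((\<lambda>p. measure (percolation p)
           {\<omega> \<in> space (percolation p).
              ereal (c1 / (p * ln (1 / p))) \<le> ereal_of_enat (eve_time (closed_set \<omega>) v) \<and>
              ereal_of_enat (eve_time (closed_set \<omega>) v) \<le> ereal (C1 * (ln (1 / p))\<^sup>2 / p\<^sup>2)})
        \<longlongrightarrow> 1) (at_right 0))"
proof (intro exI conjI allI)
  show "(1 / 200 :: real) > 0" "(73 :: real) > 0" by simp_all
  fix v :: vertex
  define W where "W p = {\<omega> \<in> space (percolation p).
    ereal (1 / 200 / (p * ln (1 / p))) \<le> ereal_of_enat (eve_time (closed_set \<omega>) v) \<and>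
    ereal_of_enat (eve_time (closed_set \<omega>) v) \<le> ereal (73 * (ln (1 / p))\<^sup>2 / p\<^sup>2)}" for p
  have bound: "1 - (24 * p * ln (1 / p) + 13 * p) \<le> measure (percolation p) (W p)"
    if p: "0 < p" "p \<le> 1 / 400" for p
  proof -
    interpret prob_space "percolation p" by (rule prob_space_percolation)
    define L where "L = ln (1 / p)"
    have "(3 :: real) \<le> 1 / p" using p by (simp add: field_simps)
    then have "exp 1 \<le> 1 / p" using exp_le by linarith
    then have L: "1 \<le> L" using p by (simp add: L_def ln_ge_iff)
    \<comment> \<open>The factor 2 makes \<open>(1 - p) ^ k \<le> p\<^sup>2\<close>, so that \<open>k * (1 - p) ^ k\<close> tends to 0.\<close>
    define k where "k = nat \<lceil>2 * L / p\<rceil>"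
    \<comment> \<open>The largest radius, up to a constant, for which sparseness is likely: \<open>48 * (2 * n + 4) * p \<le> 1\<close>.\<close>
    define n where "n = nat \<lfloor>1 / (200 * p)\<rfloor>"
    have Lp: "1 \<le> L / p" using p L by (simp add: field_simps)
    have k: "2 * L / p \<le> real k" "real k \<le> 3 * L / p"
      using Lp by (simp_all add: k_def) linarith+
    then have k1: "1 \<le> k" using Lp by (cases k) auto
    have n: "real n \<le> 1 / (200 * p)" "1 / (200 * p) < real n + 1"
      using p by (simp_all add: n_def)
    define bad where "bad P = {\<omega> \<in> space (percolation p). P (closed_set \<omega>)}" for P
    let ?B1 = "bad (\<lambda>K. \<not> region_closed k (base_after v) K)"
    let ?B2 = "bad (\<lambda>K. \<not> region_closed k (base_before k v) K)"
    let ?B3 = "bad (\<lambda>K. \<not> closed_sparse n (centre_base v) K)"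
    let ?B4 = "bad (\<lambda>K. v \<in> K)"
    have bad_sets: "?B1 \<in> sets (percolation p)" "?B2 \<in> sets (percolation p)"
      "?B3 \<in> sets (percolation p)" "?B4 \<in> sets (percolation p)"
      unfolding bad_def by measurable
    have W_sets: "W p \<in> sets (percolation p)"
      unfolding W_def by (rule time_window_event)
    have sub: "space (percolation p) - W p \<subseteq> ?B1 \<union> ?B2 \<union> ?B3 \<union> ?B4"
    proof (rule ccontr)
      assume "\<not> ?thesis"
      then obtain \<omega> where w: "\<omega> \<in> space (percolation p)" "\<omega> \<notin> W p"
        and good: "region_closed k (base_after v) (closed_set \<omega>)"
          "region_closed k (base_before k v) (closed_set \<omega>)"
          "closed_sparse n (centre_base v) (closed_set \<omega>)" "v \<notin> closed_set \<omega>"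
        by (auto simp: bad_def)
      have "real (Suc (8 * k\<^sup>2)) \<le> 73 * L\<^sup>2 / p\<^sup>2"
      proof -
        have "(real k)\<^sup>2 \<le> (3 * L / p)\<^sup>2" using k by (intro power_mono) auto
        moreover have "1 \<le> (L / p)\<^sup>2" using Lp by (rule one_le_power)
        ultimately show ?thesis by (simp add: power_divide power_mult_distrib)
      qed
      moreover have "eve_time (closed_set \<omega>) v \<le> enat (Suc (8 * k\<^sup>2))"
        by (rule eve_time_le_if_regions_closed[OF closed_set_odd k1 good(1,2)])
      ultimately have "ereal_of_enat (eve_time (closed_set \<omega>) v) \<le> ereal (73 * L\<^sup>2 / p\<^sup>2)"
        unfolding ereal_of_enat_le_iff by blast
      moreover have "ereal (1 / 200 / (p * L)) \<le> ereal_of_enat (eve_time (closed_set \<omega>) v)"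
        unfolding le_ereal_of_enat_iff
      proof (intro allI impI notI)
        fix t assume t: "real t < 1 / 200 / (p * L)" "eve_time (closed_set \<omega>) v \<le> enat t"
        have "1 / 200 / (p * L) \<le> 1 / (200 * p)"
          using p L by (simp add: field_simps)
        then have "t \<le> n" using t n by linarith
        then have "eve_time (closed_set \<omega>) v \<le> enat n"
          using t(2) by (meson enat_ord_simps(1) order.trans)
        then show False using eve_time_gt_if_sparse[OF good(3,4)] by blast
      qed
      ultimately show False using w by (simp add: W_def L_def)
    qed
    have region: "prob {\<omega> \<in> space (percolation p). \<not> region_closed k c (closed_set \<omega>)} \<le> 12 * p * L"
      if "odd_vertex c" for c
    proof -
      have "(1 - p) ^ k \<le> exp (- p) ^ k"
        using p exp_ge_add_one_self[of "- p"] by (intro power_mono) auto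
      also have "\<dots> = exp (- (p * real k))" by (simp add: exp_of_nat_mult[symmetric] mult.commute)
      also have "\<dots> \<le> exp (- (2 * L))" using k p by (simp add: field_simps)
      also have "\<dots> = p\<^sup>2"
        using p by (simp add: L_def ln_div exp_double power2_eq_square)
      finally have "(1 - p) ^ k \<le> p\<^sup>2" .
      then have "4 * real k * (1 - p) ^ k \<le> 4 * (3 * L / p) * p\<^sup>2"
        using k p L by (intro mult_mono) auto
      also have "\<dots> = 12 * p * L" using p by (simp add: power2_eq_square)
      finally show ?thesis using prob_region_not_closed[of p c k] p that by linarith
    qed
    have "48 * (2 * real n + 4) * p \<le> 1"
      using n(1) p by (simp add: field_simps)
    then have B3: "prob ?B3 \<le> 12 * p"
      unfolding bad_def using p by (intro prob_not_sparse centre_base_odd) auto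
    have B4: "prob ?B4 \<le> p"
    proof (cases "odd_vertex v")
      case True
      have "prob ?B4 \<le> real (card {{v}}) * (if True then p else 1 - p) ^ 1"
        using p True by (intro prob_constant_block_le) (auto simp: bad_def)
      then show ?thesis by simp
    next
      case False
      then have "?B4 = {}" by (auto simp: bad_def closed_set_def)
      then show ?thesis using p by simp
    qed
    have "1 - prob (W p) = prob (space (percolation p) - W p)"
      using prob_compl[OF W_sets] by simp
    also have "\<dots> \<le> prob (?B1 \<union> ?B2 \<union> ?B3 \<union> ?B4)"
      using sub bad_sets by (intro finite_measure_mono) auto
    also have "\<dots> \<le> prob ?B1 + prob ?B2 + prob ?B3 + prob ?B4"
      using measure_Un_le[of "?B1 \<union> ?B2 \<union> ?B3" "percolation p" ?B4]
        measure_Un_le[of "?B1 \<union> ?B2" "percolation p" ?B3]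
        measure_Un_le[of ?B1 "percolation p" ?B2] bad_sets
      by (simp add: sets.Un)
    also have "\<dots> \<le> 12 * p * L + 12 * p * L + 12 * p + p"
      using region[OF bases_odd(1)] region[OF bases_odd(2)] B3 B4
      by (intro add_mono) (auto simp: bad_def)
    finally show ?thesis by (simp add: L_def algebra_simps)
  qed
  have "((\<lambda>p. 1 - (24 * p * ln (1 / p) + 13 * p)) \<longlongrightarrow> (1::real)) (at_right 0)"
  proof -
    have "((\<lambda>p::real. ln (inverse p) / inverse p) \<longlongrightarrow> 0) (at_right 0)"
      by (rule filterlim_compose[OF ln_x_over_x_tendsto_0 filterlim_inverse_at_top_right])
    then have "((\<lambda>p::real. 1 - (24 * (ln (inverse p) / inverse p) + 13 * p)) \<longlongrightarrow> 1 - (24 * 0 + 13 * 0)) (at_right 0)"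
      by (intro tendsto_intros)
    then show ?thesis by (simp add: field_simps)
  qed
  then have "((\<lambda>p. measure (percolation p) (W p)) \<longlongrightarrow> 1) (at_right 0)"
  proof (rule tendsto_sandwich[rotated 2])
    show "\<forall>\<^sub>F p in at_right 0. 1 - (24 * p * ln (1 / p) + 13 * p) \<le> measure (percolation p) (W p)"
      using bound by (auto simp: eventually_at_right_field intro!: exI[of _ "1/400"])
    show "\<forall>\<^sub>F p in at_right 0. measure (percolation p) (W p) \<le> (1::real)"
      by (simp add: prob_space.prob_le_1[OF prob_space_percolation])
  qed simp
  then show "((\<lambda>p. measure (percolation p)
           {\<omega> \<in> space (percolation p).
              ereal (1 / 200 / (p * ln (1 / p))) \<le> ereal_of_enat (eve_time (closed_set \<omega>) v) \<and>
              ereal_of_enat (eve_time (closed_set \<omega>) v) \<le> ereal (73 * (ln (1 / p))\<^sup>2 / p\<^sup>2)})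
        \<longlongrightarrow> 1) (at_right 0)"
    unfolding W_def .
qed

end
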